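(* Let $x\in X$ and suppose $\lambda_{x,R}\to\nu$ as $R\to\infty$ in the weak-$\star$ topology, where $\nu$ is a probability measure on $X$. Let $\sigma>0$. Then $$p_0(x,\sigma):=\lim_{R\to\infty}\lambda\left(\theta: A_R^\theta(\sigma)\cap\Lambda_x=\emptyset\right)=\nu\left(y\in X:\Lambda_y\cap T(\sigma)=\emptyset\right),$$ where $T(\sigma)$ is the triangle with vertices at $(0,0)$ and $(1,\pm\sigma)$. Moreover, for each non-negative integer $i$, $$p_i(x,\sigma):=\lim_{R\to\infty}\lambda\left(\theta:|A_R^\theta(\sigma)\cap\Lambda_x|=i\right)=\nu\left(y\in X:|\Lambda_y\cap T(\sigma)|=i\right).$$
   Context: $X$ is a locally compact metric space with a continuous $SL(2,\mathbb R)$-action, together with an assignment $x\mapsto\Lambda_x$ of a countable discrete subset $\Lambda_x\subset\mathbb R^2\setminus\{0\}$ to each $x\in X$ (discrete: every bounded subset of $\mathbb R^2$ contains only finitely many points of $\Lambda_x$), which is equivariant: $\Lambda_{gx}=g\Lambda_x$ for all $g\in SL(2,\mathbb R)$, $x\in X$. $\lambda$ is the Lebesgue probability measure on the circle $S^1=\mathbb R/2\pi\mathbb Z$. $B(0,R)=\{\mathbf v\in\mathbb R^2:\|\mathbf v\|_2\le R\}$. For $\theta\in[0,2\pi)$, $\sigma>0$, $R>0$ the thinning wedge is $$A_R^\theta(\sigma)=\{\mathbf v\in B(0,R):\arg(\mathbf v)\in(\theta-\sigma R^{-2},\theta+\sigma R^{-2})\}.$$ Let $r_{-\theta}=\begin{pmatrix}\cos\theta&\sin\theta\\-\sin\theta&\cos\theta\end{pmatrix}$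 and $g_t=\begin{pmatrix}e^{-t/2}&0\\0&e^{t/2}\end{pmatrix}$. $\lambda_{x,R}$ is the probability measure $\frac{d\theta}{2\pi}$ on $\{g_tr_\theta x:0\le\theta<2\pi\}$ with $t=2\ln R$, i.e. the push-forward of $\frac{d\theta}{2\pi}$ under $\theta\mapsto g_tr_\theta x$.
   Formalization: Added: y ↦ Λ_y is continuous (vague topology, counting points) at ν-almost every y, since with equivariance alone the claim is false (e.g. SL(2,ℝ)∪{∞}, Λ_∞ empty, ν = δ_∞); ν is taken to be Radon, automatic for separable X. *)

theory Defs
  imports "HOL-Probability.Probability" "HOL-Algebra.Group_Action"
begin

definition SL2R :: "(real^2^2) monoid" where
  "SL2R = \<lparr>carrier = {A. det A = 1}, mult = (**), one = mat 1\<rparr>"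

lemma group_SL2R: "group SL2R"
proof (rule groupI)
  fix A assume "A \<in> carrier SL2R"
  then have d: "det A = 1" by (simp add: SL2R_def)
  then have "invertible A" by (simp add: invertible_det_nz)
  then obtain B where inv: "B ** A = mat 1" by (auto simp: invertible_def)
  then have "det B * det A = 1" by (metis det_mul det_I)
  with d inv show "\<exists>B\<in>carrier SL2R. B \<otimes>\<^bsub>SL2R\<^esub> A = \<one>\<^bsub>SL2R\<^esub>"
    by (auto simp: SL2R_def)
qed (auto simp: SL2R_def det_mul matrix_mul_assoc)

text \<open>
  A continuous action of \<open>SL(2,\<real>)\<close> on the whole type. The library's
  \<open>group_action\<close> takes values in bijections of its second argument; nothing is said
  about \<open>act g\<close> when \<open>g\<close> is not in \<open>carrier SL2R\<close>.
\<close>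
definition continuous_SL2R_action :: "(real^2^2 \<Rightarrow> 'a::metric_space \<Rightarrow> 'a) \<Rightarrow> bool" where
  "continuous_SL2R_action act \<longleftrightarrow>
     group_action SL2R UNIV act \<and>
     continuous_on (carrier SL2R \<times> UNIV) (\<lambda>(g, x). act g x)"

definition discrete_config :: "(real^2) set \<Rightarrow> bool" where
  "discrete_config S \<longleftrightarrow>
     countable S \<and> 0 \<notin> S \<and> (\<forall>B. bounded B \<longrightarrow> finite (S \<inter> B))"

definition equivariant :: "(real^2^2 \<Rightarrow> 'a \<Rightarrow> 'a) \<Rightarrow> ('a \<Rightarrow> (real^2) set) \<Rightarrow> bool" where
  "equivariant act \<Lambda> \<longleftrightarrow>
     (\<forall>g\<in>carrier SL2R. \<forall>x. \<Lambda> (act g x) = (\<lambda>v. g *v v) ` \<Lambda> x)"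

definition has_compact_support :: "('a::topological_space \<Rightarrow> real) \<Rightarrow> bool" where
  "has_compact_support f \<longleftrightarrow> compact (closure {x. f x \<noteq> 0})"

text \<open>
  Continuity at a point of the configuration-valued map \<open>\<Lambda>\<close> for the vague topology on
  locally finite subsets of the plane: a configuration is identified with its counting
  measure, tested against \<open>C\<^sub>c(\<real>\<^sup>2)\<close>. The test functions need not vanish at the origin,
  so points of \<open>\<Lambda> z\<close> can neither accumulate at \<open>0\<close> nor merge as \<open>z\<close> tends to \<open>y\<close>. Each
  sum has only finitely many nonzero terms when the configurations are discrete.
\<close>
definition vaguely_continuous_at :: "('a::metric_space \<Rightarrow> (real^2) set) \<Rightarrow> 'a \<Rightarrow> bool" where
  "vaguely_continuous_at \<Lambda> y \<longleftrightarrow>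
     (\<forall>f::real^2 \<Rightarrow> real. continuous_on UNIV f \<longrightarrow> has_compact_support f \<longrightarrow>
        isCont (\<lambda>z. \<Sum>\<^sub>\<infinity>v\<in>\<Lambda> z. f v) y)"

text \<open>The counterclockwise rotation \<open>r\<^sub>\<theta>\<close>.\<close>
definition rot :: "real \<Rightarrow> real^2^2" where
  "rot \<theta> = vector [vector [cos \<theta>, - sin \<theta>], vector [sin \<theta>, cos \<theta>]]"

definition geo :: "real \<Rightarrow> real^2^2" where
  "geo t = vector [vector [exp (- t / 2), 0], vector [0, exp (t / 2)]]"

text \<open>
  The Lebesgue probability measure \<open>d\<theta> / 2\<pi>\<close> on the circle, with the circle represented by
  angles in \<open>[0, 2\<pi>)\<close>; the complement of this interval in \<open>\<real>\<close> has measure zero.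
\<close>
definition circle_measure :: "real measure" where
  "circle_measure = uniform_measure lborel {0..<2 * pi}"

definition expanding_circle ::
    "(real^2^2 \<Rightarrow> 'a::metric_space \<Rightarrow> 'a) \<Rightarrow> 'a \<Rightarrow> real \<Rightarrow> 'a measure" where
  "expanding_circle act x R =
     distr circle_measure borel (\<lambda>\<theta>. act (geo (2 * ln R) ** rot \<theta>) x)"

text \<open>
  By Riesz representation, the weak-\<open>*\<close> topology lives on Radon measures; a probability
  measure on a locally compact space therefore means a Radon one. For finite Borel measures
  on a separable locally compact metric space the inner regularity below is automatic.
\<close>
definition radon_probability :: "'a::metric_space measure \<Rightarrow> bool" where
  "radon_probability \<nu> \<longleftrightarrow>
     prob_space \<nu> \<and> sets \<nu> = sets borel \<and>
     (\<forall>B\<in>sets \<nu>. emeasure \<nu> B = (SUP K\<in>{K. K \<subseteq> B \<and> compact K}. emeasure \<nu> K))"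

definition weak_star_tendsto ::
    "('i \<Rightarrow> 'a::metric_space measure) \<Rightarrow> 'a measure \<Rightarrow> 'i filter \<Rightarrow> bool" where
  "weak_star_tendsto \<mu> \<nu> F \<longleftrightarrow>
     (\<forall>f::'a \<Rightarrow> real. continuous_on UNIV f \<longrightarrow> has_compact_support f \<longrightarrow>
        ((\<lambda>i. \<integral>y. f y \<partial>\<mu> i) \<longlongrightarrow> (\<integral>y. f y \<partial>\<nu>)) F)"

text \<open>
  The condition on \<open>arg v\<close> is read modulo \<open>2\<pi>\<close>: some argument of \<open>v\<close> lies in the open
  interval. The origin, which has no argument, is left out.
\<close>
definition wedge :: "real \<Rightarrow> real \<Rightarrow> real \<Rightarrow> (real^2) set" where
  "wedge R \<theta> \<sigma> =
     {v \<in> cball 0 R. v \<noteq> 0 \<and>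
        (\<exists>\<alpha>\<in>{\<theta> - \<sigma> / R\<^sup>2 <..< \<theta> + \<sigma> / R\<^sup>2}. v = norm v *\<^sub>R vector [cos \<alpha>, sin \<alpha>])}"

definition thinning_triangle :: "real \<Rightarrow> (real^2) set" where
  "thinning_triangle \<sigma> = convex hull {0, vector [1, \<sigma>], vector [1, - \<sigma>]}"

end

theory Submission
  imports Defs "HOL-Real_Asymp.Real_Asymp"
begin

text \<open>
  Rotating by \<open>- \<theta>\<close> and applying \<open>geo (2 * ln R)\<close> turns the wedge at angle \<open>\<theta>\<close> into a
  region that depends only on \<open>R\<close> and converges to the triangle, so by equivariance the
  distribution of the wedge count is that of a triangle-like count under
  \<open>expanding_circle act x R\<close>. At a point of vague continuity whose configuration misses the
  sides of the triangle, the count is locally constant, uniformly in large \<open>R\<close>. It remains to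
  see that configurations miss the sides almost surely. The limit measure is invariant under
  the geodesic flow, which moves the vertical side to disjoint segments, and under lower
  unipotent shears, because small rotations become shears in the limit; these move the slanted
  sides to rays of different slopes. A side met with positive probability would thus give
  infinitely many essentially disjoint bounded sets met simultaneously with positive
  probability, against local finiteness.
\<close>

subsection \<open>Compactly supported functions\<close>

text \<open>Urysohn's lemma separates \<open>K\<close> from the complement of
  \<open>U \<inter> V\<close>, where \<open>V\<close> is an open neighbourhood of \<open>K\<close>
  inside a compact \<open>L\<close>. Vanishing off \<open>V\<close> forces compact support;
  vanishing off \<open>U\<close> gives the upper half of the sandwich between indicators.\<close>

lemma Urysohn_compact_support:
  fixes K U :: "'a::metric_space set"
  assumes lc: "locally_compact_space (euclidean :: 'a topology)"
    and K: "compact K" and U: "open U" and KU: "K \<subseteq> U"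
  obtains f :: "'a \<Rightarrow> real" where
    "continuous_on UNIV f" "has_compact_support f" "\<And>y. 0 \<le> f y" "\<And>y. f y \<le> 1"
    "\<And>y. y \<in> K \<Longrightarrow> f y = 1" "\<And>y. y \<notin> U \<Longrightarrow> f y = 0"
proof -
  have reg: "Hausdorff_space (euclidean :: 'a topology)"
    by (rule Hausdorff_space_euclidean)
  obtain V L where V: "open V" and L: "compact L" and KV: "K \<subseteq> V" and VL: "V \<subseteq> L"
    using lc K reg by (auto simp: locally_compact_space_compact_closed_compact)
  have norm: "normal_space (euclidean :: 'a topology)"
    by (simp add: metrizable_imp_normal_space metrizable_space_euclidean)
  obtain f where f: "continuous_map euclidean (top_of_set {0..1::real}) f"
      "f ` (- (U \<inter> V)) \<subseteq> {0}" "f ` K \<subseteq> {1}"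
  proof (rule Urysohn_lemma[OF norm, of "- (U \<inter> V)" K 0 1])
    show "closedin euclidean (- (U \<inter> V))"
      using U V by (simp add: closed_def open_Int)
    show "closedin euclidean K" using K by (simp add: compact_imp_closed)
    show "disjnt (- (U \<inter> V)) K" using KU KV by (auto simp: disjnt_def)
  qed auto
  show thesis
  proof
    show "continuous_on UNIV f" using f(1) by (simp add: continuous_map_in_subtopology)
    have "closure {y. f y \<noteq> 0} \<subseteq> L"
      using f(2) VL L by (intro closure_minimal) (auto simp: compact_imp_closed)
    then show "has_compact_support f"
      unfolding has_compact_support_def using L by (metis closed_closure compact_Int_closed inf.absorb2)
    have "f y \<in> {0..1}" for y using f(1) by (auto simp: continuous_map_in_subtopology)
    then show "0 \<le> f y" "f y \<le> 1" for y by auto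
  qed (use f in auto)
qed

lemma has_compact_support_bounded:
  fixes f :: "'a::metric_space \<Rightarrow> real"
  assumes "continuous_on UNIV f" "has_compact_support f"
  obtains B where "\<And>y. norm (f y) \<le> B"
proof -
  let ?K = "closure {y. f y \<noteq> 0}"
  have "compact (f ` ?K)"
    using assms by (intro compact_continuous_image) (auto simp: has_compact_support_def intro: continuous_on_subset)
  then obtain B where B: "\<forall>z\<in>f ` ?K. norm z \<le> B" using compact_imp_bounded bounded_iff by metis
  have "norm (f y) \<le> max 0 B" for y
  proof (cases "f y = 0")
    case False
    then have "y \<in> ?K" using closure_subset[of "{y. f y \<noteq> 0}"] by auto
    then show ?thesis using B by fastforce
  qed auto
  then show thesis using that by blast
qed

lemma integrable_compact_support:
  fixes f :: "'a::metric_space \<Rightarrow> real"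
  assumes "finite_measure M" "sets M = sets borel" "continuous_on UNIV f" "has_compact_support f"
  shows "integrable M f"
proof -
  interpret finite_measure M by fact
  obtain B where B: "\<And>y. norm (f y) \<le> B"
    using has_compact_support_bounded[OF assms(3,4)] by blast
  have "f \<in> borel_measurable borel" using assms(3) by (rule borel_measurable_continuous_onI)
  then have "f \<in> borel_measurable M" using measurable_cong_sets[OF assms(2) refl] by blast
  then show ?thesis using integrable_const_bound[of f B] B by auto
qed

subsection \<open>Rotations of the circle\<close>

lemma emeasure_lborel_reflect:
  fixes A :: "real set"
  assumes "A \<in> sets borel"
  shows "emeasure lborel {\<theta>. - \<theta> \<in> A} = emeasure lborel A"
proof -
  have "emeasure lborel A = emeasure (distr lborel borel uminus) A"
    by (simp add: lborel_distr_uminus)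
  also have "\<dots> = emeasure lborel {\<theta>. - \<theta> \<in> A}"
    using assms by (subst emeasure_distr) (auto simp: vimage_def)
  finally show ?thesis by simp
qed

lemma emeasure_lborel_shift:
  fixes A :: "real set"
  assumes "A \<in> sets borel"
  shows "emeasure lborel {\<theta>. c + \<theta> \<in> A} = emeasure lborel A"
proof -
  have "emeasure lborel A = emeasure (distr lborel borel ((+) c)) A"
    by (simp add: lborel_distr_plus)
  also have "\<dots> = emeasure lborel {\<theta>. c + \<theta> \<in> A}"
    using assms by (subst emeasure_distr) (auto simp: vimage_def)
  finally show ?thesis by simp
qed

lemma sets_circle_measure [simp, measurable_cong]: "sets circle_measure = sets borel"
  and space_circle_measure [simp]: "space circle_measure = UNIV"
  by (simp_all add: circle_measure_def)

lemma prob_space_circle_measure: "prob_space circle_measure"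
  unfolding circle_measure_def by (rule prob_space_uniform_measure) auto

lemma emeasure_circle_cong:
  assumes "A \<in> sets borel" "B \<in> sets borel"
    and "emeasure lborel ({0..<2 * pi} \<inter> A) = emeasure lborel ({0..<2 * pi} \<inter> B)"
  shows "emeasure circle_measure A = emeasure circle_measure B"
  using assms unfolding circle_measure_def by simp

text \<open>Reflection maps \<open>{0..<2 * pi}\<close> to an interval that one period brings back,
  up to endpoints of measure zero. This matters because wedges are straightened by
  \<open>rot (- \<theta>)\<close>, while \<open>expanding_circle\<close> is parametrised by
  \<open>rot \<theta>\<close>.\<close>

lemma emeasure_circle_reflect:
  assumes A [measurable]: "A \<in> sets borel"
    and per: "\<And>\<theta>. \<theta> + 2 * pi \<in> A \<longleftrightarrow> \<theta> \<in> A"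
  shows "emeasure circle_measure {\<theta>. - \<theta> \<in> A} = emeasure circle_measure A"
proof (rule emeasure_circle_cong)
  have [measurable]: "{\<theta>. - \<theta> \<in> A} \<in> sets borel"
    using measurable_sets[of "uminus :: real \<Rightarrow> real" borel borel A] A by (simp add: vimage_def)
  show "{\<theta>. - \<theta> \<in> A} \<in> sets borel" by fact
  have "emeasure lborel ({0..<2 * pi} \<inter> {\<theta>. - \<theta> \<in> A}) = emeasure lborel {\<theta>. - \<theta> \<in> {- 2 * pi<..0} \<inter> A}"
    by (rule arg_cong[where f = "emeasure lborel"]) auto
  also have "\<dots> = emeasure lborel ({- 2 * pi<..0} \<inter> A)"
    by (rule emeasure_lborel_reflect) auto
  also have "{- 2 * pi<..0} \<inter> A = {\<theta>. 2 * pi + \<theta> \<in> {0<..2 * pi} \<inter> A}"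
    using per by (auto simp: add.commute)
  also have "emeasure lborel \<dots> = emeasure lborel ({0<..2 * pi} \<inter> A)"
    by (rule emeasure_lborel_shift) auto
  also have "\<dots> = emeasure lborel ({0..<2 * pi} \<inter> A)"
  proof (rule emeasure_eq_AE)
    show "AE \<theta> in lborel. (\<theta> \<in> {0<..2 * pi} \<inter> A) = (\<theta> \<in> {0..<2 * pi} \<inter> A)"
      using AE_lborel_singleton[of 0] AE_lborel_singleton[of "2 * pi"] by eventually_elim auto
  qed auto
  finally show "emeasure lborel ({0..<2 * pi} \<inter> {\<theta>. - \<theta> \<in> A}) = emeasure lborel ({0..<2 * pi} \<inter> A)" .
qed fact

text \<open>The shifted period \<open>{c..<2 * pi + c}\<close> is cut at \<open>2 * pi\<close>, and
  periodicity moves the overhang back to \<open>{0..<c}\<close>.\<close>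

lemma emeasure_circle_shift:
  assumes A [measurable]: "A \<in> sets borel"
    and per: "\<And>\<theta>. \<theta> + 2 * pi \<in> A \<longleftrightarrow> \<theta> \<in> A"
    and c: "0 \<le> c" "c \<le> 2 * pi"
  shows "emeasure circle_measure {\<theta>. c + \<theta> \<in> A} = emeasure circle_measure A"
proof (rule emeasure_circle_cong)
  show "{\<theta>. c + \<theta> \<in> A} \<in> sets borel"
    using measurable_sets[of "(+) c" borel borel A] A by (simp add: vimage_def)
  have "emeasure lborel ({0..<2 * pi} \<inter> {\<theta>. c + \<theta> \<in> A})
      = emeasure lborel {\<theta>. c + \<theta> \<in> {c..<2 * pi + c} \<inter> A}"
    by (rule arg_cong[where f = "emeasure lborel"]) auto
  also have "\<dots> = emeasure lborel ({c..<2 * pi + c} \<inter> A)"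
    by (rule emeasure_lborel_shift) auto
  also have "{c..<2 * pi + c} \<inter> A = ({c..<2 * pi} \<inter> A) \<union> ({2 * pi..<2 * pi + c} \<inter> A)"
    using c by auto
  also have "emeasure lborel \<dots> = emeasure lborel ({c..<2 * pi} \<inter> A) + emeasure lborel ({2 * pi..<2 * pi + c} \<inter> A)"
    by (rule plus_emeasure[symmetric]) auto
  also have "emeasure lborel ({2 * pi..<2 * pi + c} \<inter> A)
      = emeasure lborel {\<theta>. 2 * pi + \<theta> \<in> {2 * pi..<2 * pi + c} \<inter> A}"
    by (rule emeasure_lborel_shift[symmetric]) auto
  also have "{\<theta>. 2 * pi + \<theta> \<in> {2 * pi..<2 * pi + c} \<inter> A} = {0..<c} \<inter> A"
    using per by (auto simp: add.commute)
  also have "emeasure lborel ({c..<2 * pi} \<inter> A) + emeasure lborel ({0..<c} \<inter> A)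
      = emeasure lborel (({c..<2 * pi} \<inter> A) \<union> ({0..<c} \<inter> A))"
    by (rule plus_emeasure) auto
  also have "({c..<2 * pi} \<inter> A) \<union> ({0..<c} \<inter> A) = {0..<2 * pi} \<inter> A"
    using c by auto
  finally show "emeasure lborel ({0..<2 * pi} \<inter> {\<theta>. c + \<theta> \<in> A}) = emeasure lborel ({0..<2 * pi} \<inter> A)" .
qed fact

subsection \<open>Matrices in \<open>SL(2,\<real>)\<close>\<close>

lemma geo_log: "R > 0 \<Longrightarrow> geo (2 * ln R) = vector [vector [1 / R, 0], vector [0, R]]"
  by (simp add: geo_def exp_minus inverse_eq_divide)

lemma det_2x2_vector:
  "det (vector [vector [a, b], vector [c, d]] :: real^2^2) = a * d - b * c"
  by (simp add: det_2 vector_2)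

lemma matrix_2x2_eqI:
  fixes A B :: "'a^2^2"
  assumes "A $ 1 $ 1 = B $ 1 $ 1" "A $ 1 $ 2 = B $ 1 $ 2" "A $ 2 $ 1 = B $ 2 $ 1" "A $ 2 $ 2 = B $ 2 $ 2"
  shows "A = B"
proof -
  have "A $ i $ j = B $ i $ j" for i j
    using assms exhaust_2[of i] exhaust_2[of j] by auto
  then show ?thesis by (metis vec_eq_iff)
qed

lemma matrix_mul_2x2_vector:
  "(vector [vector [a, b], vector [c, d]] :: real^2^2) ** (vector [vector [a', b'], vector [c', d']] :: real^2^2)
    = vector [vector [a * a' + b * c', a * b' + b * d'], vector [c * a' + d * c', c * b' + d * d']]"
  by (rule matrix_2x2_eqI) (simp_all add: matrix_matrix_mult_def sum_2 vector_2)

lemma matrix_vector_mul_2x2_vector: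
  "(vector [vector [a, b], vector [c, d]] :: real^2^2) *v v
    = vector [a * v $ 1 + b * v $ 2, c * v $ 1 + d * v $ 2]"
  by (simp add: vec_eq_iff forall_2 matrix_vector_mult_def sum_2 vector_2)

lemma mem_SL2R: "A \<in> carrier SL2R \<longleftrightarrow> det A = 1"
  and mult_SL2R [simp]: "A \<otimes>\<^bsub>SL2R\<^esub> B = A ** B"
  by (simp_all add: SL2R_def)

lemma SL2R_mult: "A \<in> carrier SL2R \<Longrightarrow> B \<in> carrier SL2R \<Longrightarrow> A ** B \<in> carrier SL2R"
  by (simp add: mem_SL2R det_mul)

lemma geo_SL2R: "geo t \<in> carrier SL2R"
  by (simp add: mem_SL2R geo_def det_2x2_vector flip: exp_add)

lemma rot_SL2R: "rot \<theta> \<in> carrier SL2R"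
  by (simp add: mem_SL2R rot_def det_2x2_vector flip: power2_eq_square)

lemma geo_add: "geo s ** geo t = geo (s + t)"
  by (simp add: geo_def matrix_mul_2x2_vector add_divide_distrib diff_divide_distrib flip: exp_add)

lemma geo_0: "geo 0 = mat 1"
  by (rule matrix_2x2_eqI) (simp_all add: geo_def mat_def vector_2)

lemma rot_add: "rot a ** rot b = rot (a + b)"
  by (simp add: rot_def matrix_mul_2x2_vector cos_add sin_add algebra_simps)

lemma rot_periodic: "rot (\<theta> + 2 * pi) = rot \<theta>"
  by (simp add: rot_def)

lemma continuous_rot: "continuous_on UNIV rot"
  unfolding continuous_on_def
proof (intro ballI vec_tendstoI)
  fix \<theta> :: real and i j :: 2
  show "((\<lambda>\<phi>. rot \<phi> $ i $ j) \<longlongrightarrow> rot \<theta> $ i $ j) (at \<theta> within UNIV)"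
    using exhaust_2[of i] exhaust_2[of j]
    by (auto simp: rot_def vector_2 intro!: tendsto_cos tendsto_sin tendsto_minus tendsto_ident_at)
qed

text \<open>The horocycle subgroup expanded by the flow: conjugation by \<open>geo t\<close>
  multiplies the parameter \<open>s\<close> by \<open>exp t\<close>.\<close>

definition shear :: "real \<Rightarrow> real^2^2" where
  "shear s = vector [vector [1, 0], vector [s, 1]]"

lemma shear_SL2R: "shear s \<in> carrier SL2R"
  by (simp add: mem_SL2R shear_def det_2x2_vector)

text \<open>Under the geodesic flow, small rotations become horocycle shears.\<close>
lemma geo_rot_geo_tendsto_shear:
  "((\<lambda>R. geo (2 * ln R) ** rot (s / R\<^sup>2) ** geo (- (2 * ln R))) \<longlongrightarrow> shear s) at_top"
proof -
  \<comment> \<open>Conjugation by \<open>geo (2 * ln R)\<close>, the diagonal matrix with entries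
    \<open>1 / R\<close> and \<open>R\<close>, multiplies the lower left entry by
    \<open>R\<^sup>2\<close> and divides the upper right one by it. The angle
    \<open>s / R\<^sup>2\<close> is scaled so that the former tends to \<open>s\<close>.\<close>
  have *: "((\<lambda>R. vector [vector [cos (s / R\<^sup>2), - sin (s / R\<^sup>2) / R\<^sup>2],
        vector [R\<^sup>2 * sin (s / R\<^sup>2), cos (s / R\<^sup>2)]] :: real^2^2) \<longlongrightarrow> shear s) at_top"
    unfolding shear_def
  proof (intro vec_tendstoI)
    fix i j :: 2
    show "((\<lambda>R. (vector [vector [cos (s / R\<^sup>2), - sin (s / R\<^sup>2) / R\<^sup>2],
        vector [R\<^sup>2 * sin (s / R\<^sup>2), cos (s / R\<^sup>2)]] :: real^2^2) $ i $ j)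
        \<longlongrightarrow> (vector [vector [1, 0], vector [s, 1]] :: real^2^2) $ i $ j) at_top"
      using exhaust_2[of i] exhaust_2[of j]
      by (auto simp: vector_2) real_asymp+
  qed
  show ?thesis
  proof (rule Lim_transform_eventually[OF *])
    show "\<forall>\<^sub>F R in at_top. vector [vector [cos (s / R\<^sup>2), - sin (s / R\<^sup>2) / R\<^sup>2],
        vector [R\<^sup>2 * sin (s / R\<^sup>2), cos (s / R\<^sup>2)]]
        = geo (2 * ln R) ** rot (s / R\<^sup>2) ** geo (- (2 * ln R))"
      using eventually_gt_at_top[of 0]
    proof eventually_elim
      case (elim R)
      then have "geo (- (2 * ln R)) = vector [vector [R, 0], vector [0, 1 / R]]"
        by (simp add: geo_def exp_minus inverse_eq_divide)
      then show ?case
        using elim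
        by (simp only: geo_log rot_def matrix_mul_2x2_vector) (simp add: power2_eq_square mult_ac)
    qed
  qed
qed

subsection \<open>Local constancy of counts\<close>

lemma infsum_eq_sum_bounded_support:
  fixes f :: "real^2 \<Rightarrow> real"
  assumes "discrete_config A" "bounded W" "\<And>v. v \<notin> W \<Longrightarrow> f v = 0"
  shows "(\<Sum>\<^sub>\<infinity>v\<in>A. f v) = (\<Sum>v\<in>A \<inter> W. f v)"
proof -
  have "finite (A \<inter> W)" using assms by (simp add: discrete_config_def)
  moreover have "(\<Sum>\<^sub>\<infinity>v\<in>A. f v) = (\<Sum>\<^sub>\<infinity>v\<in>A \<inter> W. f v)"
    using assms(3) by (intro infsum_cong_neutral) auto
  ultimately show ?thesis by simp
qed

text \<open>
  Sandwiching \<open>S\<close> between the supports of two bump functions pins the integer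
  \<open>card (\<Lambda> z \<inter> S)\<close> down to within one half, uniformly in \<open>S\<close>.
\<close>
lemma card_locally_constant:
  fixes \<Lambda> :: "'a::metric_space \<Rightarrow> (real^2) set"
  assumes disc: "\<And>z. discrete_config (\<Lambda> z)" and vc: "vaguely_continuous_at \<Lambda> y"
    and B1: "open B1" and B2: "compact B2" "B2 \<subseteq> V" and V: "open V" "bounded V"
    and sub: "B1 \<subseteq> B2" "\<Lambda> y \<inter> V \<subseteq> B1"
  shows "\<forall>\<^sub>F z in nhds y. \<forall>S. B1 \<subseteq> S \<longrightarrow> S \<subseteq> B2 \<longrightarrow> card (\<Lambda> z \<inter> S) = card (\<Lambda> y \<inter> V)"
proof -
  let ?k = "card (\<Lambda> y \<inter> V)"
  have fin: "finite (\<Lambda> z \<inter> W)" if "bounded W" for z W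
    using disc[of z] that by (simp add: discrete_config_def)
  have lc: "locally_compact_space (euclidean :: (real^2) topology)"
    by (rule locally_compact_space_euclidean)
  have bB2: "bounded B2" using B2(1) by (rule compact_imp_bounded)
  have bB1: "bounded B1" using bB2 sub(1) bounded_subset by blast
  \<comment> \<open>The finite set \<open>\<Lambda> y \<inter> V\<close> is compact, so
    \<open>f\<close> can equal 1 on it and vanish off \<open>B1\<close>; \<open>g\<close> equals 1
    on \<open>B2\<close> and vanishes off \<open>V\<close>. At \<open>y\<close> both sums equal
    \<open>?k\<close>, and for every \<open>z\<close> they bound
    \<open>card (\<Lambda> z \<inter> S)\<close> from below and above.\<close>
  obtain f :: "real^2 \<Rightarrow> real" where f: "continuous_on UNIV f" "has_compact_support f" "\<And>v. 0 \<le> f v"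
      "\<And>v. f v \<le> 1" "\<And>v. v \<in> \<Lambda> y \<inter> V \<Longrightarrow> f v = 1" "\<And>v. v \<notin> B1 \<Longrightarrow> f v = 0"
    using Urysohn_compact_support[OF lc finite_imp_compact[OF fin[OF V(2)]] B1 sub(2)] by blast
  obtain g :: "real^2 \<Rightarrow> real" where g: "continuous_on UNIV g" "has_compact_support g" "\<And>v. 0 \<le> g v"
      "\<And>v. g v \<le> 1" "\<And>v. v \<in> B2 \<Longrightarrow> g v = 1" "\<And>v. v \<notin> V \<Longrightarrow> g v = 0"
    using Urysohn_compact_support[OF lc B2(1) V(1) B2(2)] by blast
  have tends: "((\<lambda>z. \<Sum>\<^sub>\<infinity>v\<in>\<Lambda> z. h v) \<longlongrightarrow> (\<Sum>\<^sub>\<infinity>v\<in>\<Lambda> y. h v)) (nhds y)"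
    if "continuous_on UNIV h" "has_compact_support h" for h :: "real^2 \<Rightarrow> real"
    using vc that unfolding vaguely_continuous_at_def isCont_def
    using tendsto_at_iff_tendsto_nhds[of "\<lambda>z. infsum h (\<Lambda> z)" y] by blast
  have "(\<Sum>\<^sub>\<infinity>v\<in>\<Lambda> y. f v) = (\<Sum>v\<in>\<Lambda> y \<inter> V. f v)"
    using f(6) B2(2) sub(1) by (intro infsum_eq_sum_bounded_support disc V) auto
  then have fy: "(\<Sum>\<^sub>\<infinity>v\<in>\<Lambda> y. f v) = ?k" using f(5) by simp
  have "(\<Sum>\<^sub>\<infinity>v\<in>\<Lambda> y. g v) = (\<Sum>v\<in>\<Lambda> y \<inter> V. g v)"
    using g(6) by (intro infsum_eq_sum_bounded_support disc V) auto
  also have "\<dots> = (\<Sum>v\<in>\<Lambda> y \<inter> V. 1)" using g(5) sub by (intro sum.cong) auto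
  finally have gy: "(\<Sum>\<^sub>\<infinity>v\<in>\<Lambda> y. g v) = ?k" by simp
  have "\<forall>\<^sub>F z in nhds y. (\<Sum>\<^sub>\<infinity>v\<in>\<Lambda> z. f v) > real ?k - 1/2"
    using tends[OF f(1,2)] fy by (intro order_tendstoD(1)) auto
  moreover have "\<forall>\<^sub>F z in nhds y. (\<Sum>\<^sub>\<infinity>v\<in>\<Lambda> z. g v) < real ?k + 1/2"
    using tends[OF g(1,2)] gy by (intro order_tendstoD(2)) auto
  ultimately show ?thesis
  proof eventually_elim
    case (elim z)
    show ?case
    proof (intro allI impI)
      fix S assume S: "B1 \<subseteq> S" "S \<subseteq> B2"
      have bS: "bounded S" using bB2 S(2) bounded_subset by blast
      have "(\<Sum>\<^sub>\<infinity>v\<in>\<Lambda> z. f v) = (\<Sum>v\<in>\<Lambda> z \<inter> S. f v)"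
        using S f(6) by (intro infsum_eq_sum_bounded_support disc bS) auto
      also have "\<dots> \<le> (\<Sum>v\<in>\<Lambda> z \<inter> S. 1)" using f(4) by (intro sum_mono) auto
      finally have 1: "(\<Sum>\<^sub>\<infinity>v\<in>\<Lambda> z. f v) \<le> card (\<Lambda> z \<inter> S)" by simp
      have "(\<Sum>v\<in>\<Lambda> z \<inter> S. 1) = (\<Sum>v\<in>\<Lambda> z \<inter> S. g v)" using S g(5) by (intro sum.cong) auto
      also have "\<dots> \<le> (\<Sum>v\<in>\<Lambda> z \<inter> V. g v)"
        using S B2(2) g(3) fin[OF V(2)] by (intro sum_mono2) auto
      also have "\<dots> = (\<Sum>\<^sub>\<infinity>v\<in>\<Lambda> z. g v)"
        using g(6) by (intro infsum_eq_sum_bounded_support[symmetric] disc V) auto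
      finally have 2: "card (\<Lambda> z \<inter> S) \<le> (\<Sum>\<^sub>\<infinity>v\<in>\<Lambda> z. g v)" by simp
      show "card (\<Lambda> z \<inter> S) = ?k" using 1 2 elim by linarith
    qed
  qed
qed

subsection \<open>Wedges and the triangle\<close>

lemma norm_vec2: "norm (v :: real^2) = sqrt ((v $ 1)\<^sup>2 + (v $ 2)\<^sup>2)"
  by (simp add: norm_vec_def L2_set_def sum_2)

lemma vec2_eqI: "v $ 1 = w $ 1 \<Longrightarrow> v $ 2 = w $ 2 \<Longrightarrow> v = (w :: 'a^2)"
  by (simp add: vec_eq_iff forall_2)

lemma mem_wedge_iff:
  "v \<in> wedge R \<theta> \<sigma> \<longleftrightarrow>
     (\<exists>r \<alpha>. 0 < r \<and> r \<le> R \<and> \<bar>\<alpha> - \<theta>\<bar> < \<sigma> / R\<^sup>2 \<and> v = vector [r * cos \<alpha>, r * sin \<alpha>])"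
proof
  assume "v \<in> wedge R \<theta> \<sigma>"
  then obtain \<alpha> where "\<alpha> \<in> {\<theta> - \<sigma> / R\<^sup>2 <..< \<theta> + \<sigma> / R\<^sup>2}" "v = norm v *\<^sub>R vector [cos \<alpha>, sin \<alpha>]"
      "norm v \<le> R" "v \<noteq> 0"
    by (auto simp: wedge_def)
  moreover from this(2) have "v = vector [norm v * cos \<alpha>, norm v * sin \<alpha>]"
    by (intro vec2_eqI) (simp_all add: vector_2, (metis vector_2 vector_scaleR_component real_scaleR_def)+)
  moreover have "0 < norm v" "\<bar>\<alpha> - \<theta>\<bar> < \<sigma> / R\<^sup>2" using calculation by (auto simp: abs_less_iff)
  ultimately show "\<exists>r \<alpha>. 0 < r \<and> r \<le> R \<and> \<bar>\<alpha> - \<theta>\<bar> < \<sigma> / R\<^sup>2 \<and> v = vector [r * cos \<alpha>, r * sin \<alpha>]"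
    by blast
next
  assume "\<exists>r \<alpha>. 0 < r \<and> r \<le> R \<and> \<bar>\<alpha> - \<theta>\<bar> < \<sigma> / R\<^sup>2 \<and> v = vector [r * cos \<alpha>, r * sin \<alpha>]"
  then obtain r \<alpha> where r: "0 < r" "r \<le> R" "\<bar>\<alpha> - \<theta>\<bar> < \<sigma> / R\<^sup>2" and v: "v = vector [r * cos \<alpha>, r * sin \<alpha>]"
    by blast
  have n: "norm v = r"
    using r by (simp add: v norm_vec2 vector_2 power_mult_distrib flip: distrib_left)
  then have "v = norm v *\<^sub>R vector [cos \<alpha>, sin \<alpha>]"
    by (intro vec2_eqI) (simp_all add: v vector_2)
  then show "v \<in> wedge R \<theta> \<sigma>"
    using r n unfolding wedge_def by (auto simp: abs_less_iff)
qed

lemma bounded_wedge: "bounded (wedge R \<theta> \<sigma>)"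
  by (rule bounded_subset[OF bounded_cball[of 0 R]]) (auto simp: wedge_def)

text \<open>For fixed \<open>v\<close> in the ball, nonzero, the admissible angles are those within
  \<open>\<sigma> / R\<^sup>2\<close> of some argument of \<open>v\<close>, a union of open
  intervals. Measurability of the wedge count in the angle rests on this.\<close>

lemma open_wedge_angles: "open {\<theta>. v \<in> wedge R \<theta> \<sigma>}"
proof (cases "v \<in> cball 0 R \<and> v \<noteq> 0")
  case True
  then have "{\<theta>. v \<in> wedge R \<theta> \<sigma>}
      = (\<Union>\<alpha>\<in>{\<alpha>. v = norm v *\<^sub>R vector [cos \<alpha>, sin \<alpha>]}. {\<alpha> - \<sigma> / R\<^sup>2 <..< \<alpha> + \<sigma> / R\<^sup>2})"
    by (auto simp: wedge_def algebra_simps)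
  then show ?thesis by (auto intro: open_UN)
next
  case False
  then have "{\<theta>. v \<in> wedge R \<theta> \<sigma>} = {}" by (auto simp: wedge_def)
  then show ?thesis by simp
qed

lemma rot_image_wedge: "(\<lambda>v. rot \<phi> *v v) ` wedge R \<theta> \<sigma> = wedge R (\<theta> + \<phi>) \<sigma>"
proof -
  have sub: "rot \<phi> *v v \<in> wedge R (\<theta> + \<phi>) \<sigma>" if v: "v \<in> wedge R \<theta> \<sigma>" for v \<theta> \<phi>
  proof -
    obtain r \<alpha> where r: "0 < r" "r \<le> R" "\<bar>\<alpha> - \<theta>\<bar> < \<sigma> / R\<^sup>2" "v = vector [r * cos \<alpha>, r * sin \<alpha>]"
      using v by (auto simp: mem_wedge_iff)
    have "rot \<phi> *v v = vector [r * cos (\<alpha> + \<phi>), r * sin (\<alpha> + \<phi>)]"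
      by (simp add: r(4) rot_def matrix_vector_mul_2x2_vector vector_2 cos_add sin_add algebra_simps)
    moreover have "\<bar>(\<alpha> + \<phi>) - (\<theta> + \<phi>)\<bar> < \<sigma> / R\<^sup>2" using r(3) by simp
    ultimately show ?thesis using r(1,2) unfolding mem_wedge_iff by blast
  qed
  show ?thesis
  proof (intro equalityI subsetI)
    fix w assume w: "w \<in> wedge R (\<theta> + \<phi>) \<sigma>"
    have "rot 0 = mat 1"
      by (rule matrix_2x2_eqI) (simp_all add: rot_def mat_def vector_2)
    then have "w = rot \<phi> *v (rot (- \<phi>) *v w)"
      by (simp add: matrix_vector_mul_assoc rot_add)
    moreover have "rot (- \<phi>) *v w \<in> wedge R \<theta> \<sigma>" using sub[OF w, of "- \<phi>"] by simp
    ultimately show "w \<in> (\<lambda>v. rot \<phi> *v v) ` wedge R \<theta> \<sigma>" by blast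
  qed (use sub in auto)
qed

text \<open>For \<open>\<sigma> > 0\<close> this function is nonnegative exactly on the triangle and
  zero exactly on its sides. Its superlevel sets, open for \<open>> e\<close> and compact for
  \<open>\<ge> - e\<close>, are the inner and outer approximations between which the triangle and
  the rescaled wedges are squeezed.\<close>

definition triangle_depth :: "real \<Rightarrow> real^2 \<Rightarrow> real" where
  "triangle_depth \<sigma> v = min (1 - v $ 1) (\<sigma> * v $ 1 - \<bar>v $ 2\<bar>)"

lemma continuous_triangle_depth: "continuous_on UNIV (triangle_depth \<sigma>)"
  unfolding triangle_depth_def[abs_def] by (intro continuous_intros)

lemma bounded_triangle_depth:
  assumes "\<sigma> > 0"
  shows "bounded {v. triangle_depth \<sigma> v \<ge> - e}"
proof (rule bounded_subset[OF bounded_cbox])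
  show "{v. triangle_depth \<sigma> v \<ge> - e} \<subseteq> cbox (vector [- e / \<sigma>, - (\<sigma> * (1 + e) + e)]) (vector [1 + e, \<sigma> * (1 + e) + e])"
  proof clarify
    fix v assume "triangle_depth \<sigma> v \<ge> - e"
    then have v: "v $ 1 \<le> 1 + e" "\<bar>v $ 2\<bar> \<le> \<sigma> * v $ 1 + e" by (auto simp: triangle_depth_def)
    have "\<sigma> * v $ 1 \<le> \<sigma> * (1 + e)" using v(1) assms by (intro mult_left_mono) auto
    then have "\<bar>v $ 2\<bar> \<le> \<sigma> * (1 + e) + e" using v(2) by linarith
    moreover have "- e / \<sigma> \<le> v $ 1" using v(2) assms by (simp add: field_simps)
    ultimately show "v \<in> cbox (vector [- e / \<sigma>, - (\<sigma> * (1 + e) + e)]) (vector [1 + e, \<sigma> * (1 + e) + e])"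
      using v(1) by (auto simp: mem_box_cart forall_2 vector_2)
  qed
qed

lemma thinning_triangle_eq:
  assumes "\<sigma> > 0"
  shows "thinning_triangle \<sigma> = {v. triangle_depth \<sigma> v \<ge> 0}"
proof (intro equalityI subsetI)
  fix p assume "p \<in> thinning_triangle \<sigma>"
  then obtain u v w where "0 \<le> u" "0 \<le> v" "0 \<le> w" "u + v + w = 1"
      "p = u *\<^sub>R 0 + v *\<^sub>R vector [1, \<sigma>] + w *\<^sub>R vector [1, - \<sigma>]"
    unfolding thinning_triangle_def convex_hull_3 by blast
  then have p: "p $ 1 = v + w" "p $ 2 = \<sigma> * (v - w)" "u = 1 - (v + w)" "0 \<le> u" "0 \<le> v" "0 \<le> w"
    by (auto simp: vector_2 algebra_simps)
  have "\<bar>\<sigma> * (v - w)\<bar> \<le> \<sigma> * (v + w)" using p assms by (auto simp: abs_mult)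
  then show "p \<in> {v. triangle_depth \<sigma> v \<ge> 0}" using p by (auto simp: triangle_depth_def)
next
  fix p assume "p \<in> {v. triangle_depth \<sigma> v \<ge> 0}"
  then have p: "p $ 1 \<le> 1" "\<bar>p $ 2\<bar> \<le> \<sigma> * p $ 1" by (auto simp: triangle_depth_def)
  then have "\<bar>p $ 2 / \<sigma>\<bar> \<le> p $ 1" using assms by (simp add: field_simps)
  \<comment> \<open>Barycentric weights of the vertices \<open>(1, \<sigma>)\<close> and
    \<open>(1, - \<sigma>)\<close>, found by solving \<open>?v + ?w = p $ 1\<close> and
    \<open>\<sigma> * (?v - ?w) = p $ 2\<close>.\<close>
  let ?v = "(p $ 1 + p $ 2 / \<sigma>) / 2" and ?w = "(p $ 1 - p $ 2 / \<sigma>) / 2"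
  have "p = (1 - p $ 1) *\<^sub>R 0 + ?v *\<^sub>R vector [1, \<sigma>] + ?w *\<^sub>R vector [1, - \<sigma>]"
    by (rule vec2_eqI) (use assms in \<open>auto simp: vector_2 field_simps\<close>)
  moreover have "0 \<le> 1 - p $ 1" "0 \<le> ?v" "0 \<le> ?w" "(1 - p $ 1) + ?v + ?w = 1"
    using p(1) \<open>\<bar>p $ 2 / \<sigma>\<bar> \<le> p $ 1\<close> by argo+
  ultimately show "p \<in> thinning_triangle \<sigma>"
    unfolding thinning_triangle_def convex_hull_3 by blast
qed

text \<open>Angle 0 is enough, since \<open>rot (- \<theta>)\<close> carries the wedge at angle
  \<open>\<theta>\<close> to it. A point with polar coordinates \<open>r\<close>,
  \<open>\<beta>\<close> is sent to
  \<open>(r / R * cos \<beta>, R * r * sin \<beta>)\<close>.\<close>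

definition rescaled_wedge :: "real \<Rightarrow> real \<Rightarrow> (real^2) set" where
  "rescaled_wedge R \<sigma> = (\<lambda>v. geo (2 * ln R) *v v) ` wedge R 0 \<sigma>"

text \<open>The image has first coordinate at most 1, and its second coordinate is at most
  \<open>r / R * \<sigma>\<close> in absolute value because
  \<open>R\<^sup>2 * \<bar>sin \<beta>\<bar> \<le> \<sigma>\<close>. Against the slope condition of
  the triangle this loses at most \<open>\<sigma> * (1 - cos \<beta>)\<close>, which is small since
  \<open>\<bar>\<beta>\<bar> < \<sigma> / R\<^sup>2\<close>.\<close>

lemma eventually_rescaled_wedge_subset:
  assumes "\<sigma> > 0" "e > 0"
  shows "\<forall>\<^sub>F R in at_top. rescaled_wedge R \<sigma> \<subseteq> {v. triangle_depth \<sigma> v \<ge> - e}"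
proof -
  have "((\<lambda>\<beta>::real. \<sigma> * (1 - cos \<beta>)) \<longlongrightarrow> \<sigma> * (1 - cos 0)) (at 0)" by (intro tendsto_intros)
  then have "\<forall>\<^sub>F \<beta> in at 0. \<sigma> * (1 - cos \<beta>) < e" using assms by (intro order_tendstoD(2)) auto
  then obtain d where d: "d > 0" "\<And>\<beta>. \<beta> \<noteq> 0 \<Longrightarrow> dist \<beta> 0 < d \<Longrightarrow> \<sigma> * (1 - cos \<beta>) < e"
    unfolding eventually_at by blast
  have "((\<lambda>R. \<sigma> / R\<^sup>2) \<longlongrightarrow> 0) at_top" by real_asymp
  then have "\<forall>\<^sub>F R in at_top. \<sigma> / R\<^sup>2 < d" using d by (intro order_tendstoD(2)) auto
  then show ?thesis using eventually_gt_at_top[of 0]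
  proof eventually_elim
    case (elim R)
    show ?case unfolding rescaled_wedge_def
    proof clarify
      fix v assume "v \<in> wedge R 0 \<sigma>"
      then obtain r \<beta> where r: "0 < r" "r \<le> R" "\<bar>\<beta>\<bar> < \<sigma> / R\<^sup>2" "v = vector [r * cos \<beta>, r * sin \<beta>]"
        by (auto simp: mem_wedge_iff)
      have "\<sigma> * (1 - cos \<beta>) < e"
      proof (cases "\<beta> = 0")
        case False
        then show ?thesis using d(2)[of \<beta>] r(3) elim by auto
      qed (use assms in auto)
      have rR: "0 \<le> r / R" "r / R \<le> 1" using r elim by auto
      have "r / R * cos \<beta> \<le> r / R * 1" using rR by (intro mult_left_mono) auto
      then have "r / R * cos \<beta> \<le> 1" using rR by simp
      have "R\<^sup>2 * \<bar>sin \<beta>\<bar> \<le> \<sigma>"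
      proof -
        have "R\<^sup>2 * \<bar>sin \<beta>\<bar> \<le> R\<^sup>2 * \<bar>\<beta>\<bar>" using abs_sin_x_le_abs_x by (intro mult_left_mono) auto
        also have "\<dots> \<le> \<sigma>" using r(3) elim by (simp add: field_simps)
        finally show ?thesis .
      qed
      then have "r / R * (R\<^sup>2 * \<bar>sin \<beta>\<bar>) \<le> r / R * \<sigma>" using rR by (intro mult_left_mono) auto
      then have "\<bar>R * (r * sin \<beta>)\<bar> \<le> r / R * \<sigma>"
        using r(1) elim by (simp add: abs_mult power2_eq_square field_simps)
      moreover have "r / R * (\<sigma> * (1 - cos \<beta>)) \<le> 1 * (\<sigma> * (1 - cos \<beta>))"
        using rR assms by (intro mult_right_mono) auto
      then have "r / R * \<sigma> - \<sigma> * (r / R * cos \<beta>) \<le> e"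
        using \<open>\<sigma> * (1 - cos \<beta>) < e\<close> by (simp add: algebra_simps)
      ultimately have "\<bar>R * (r * sin \<beta>)\<bar> - \<sigma> * (r / R * cos \<beta>) \<le> e" by linarith
      moreover have "geo (2 * ln R) *v v = vector [r / R * cos \<beta>, R * (r * sin \<beta>)]"
        using elim by (simp only: geo_log r(4) matrix_vector_mul_2x2_vector) (simp add: vector_2)
      ultimately show "triangle_depth \<sigma> (geo (2 * ln R) *v v) \<ge> - e"
        using \<open>r / R * cos \<beta> \<le> 1\<close> assms
        unfolding triangle_depth_def min.bounded_iff by (simp only: vector_2) linarith
    qed
  qed
qed

text \<open>The preimage of \<open>w\<close> satisfies the angle condition because
  \<open>arctan\<close> is at most its argument in absolute value. Its squared radius is
  \<open>R\<^sup>2\<close> times \<open>(w $ 1)\<^sup>2 + (w $ 2)\<^sup>2 / R ^ 4\<close>: depth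
  above \<open>e\<close> leaves a margin \<open>e\<close> in the first term, which absorbs the
  second once \<open>\<sigma>\<^sup>2 / R ^ 4 < e\<close>.\<close>

lemma eventually_subset_rescaled_wedge:
  assumes "\<sigma> > 0" "e > 0"
  shows "\<forall>\<^sub>F R in at_top. {v. triangle_depth \<sigma> v > e} \<subseteq> rescaled_wedge R \<sigma>"
proof -
  have "((\<lambda>R. \<sigma>\<^sup>2 / R ^ 4) \<longlongrightarrow> 0) at_top" by real_asymp
  then have "\<forall>\<^sub>F R in at_top. \<sigma>\<^sup>2 / R ^ 4 < e" using assms by (intro order_tendstoD(2)) auto
  then show ?thesis using eventually_gt_at_top[of 0]
  proof eventually_elim
    case (elim R)
    show ?case
    proof clarify
      fix w assume "triangle_depth \<sigma> w > e"
      then have w: "w $ 1 < 1 - e" "\<bar>w $ 2\<bar> < \<sigma> * w $ 1 - e" by (auto simp: triangle_depth_def)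
      then have w1: "w $ 1 > 0" using assms by (smt (verit) mult_nonneg_nonpos)
      \<comment> \<open>The preimage of \<open>w\<close> under \<open>geo (2 * ln R)\<close> is
        \<open>(R * w $ 1, w $ 2 / R)\<close>; \<open>q\<close> is the tangent of its angle and
        \<open>r\<close> its radius.\<close>
      define q where "q = w $ 2 / (R\<^sup>2 * w $ 1)"
      define r where "r = R * w $ 1 * sqrt (1 + q\<^sup>2)"
      have sq: "sqrt (1 + q\<^sup>2) > 0" by (simp add: add_pos_nonneg)
      have "r > 0" using elim w1 sq by (simp add: r_def)
      have "\<bar>w $ 2\<bar> \<le> \<sigma>"
      proof -
        have "\<sigma> * w $ 1 \<le> \<sigma> * 1" using w(1) assms by (intro mult_left_mono) auto
        then show ?thesis using w(2) assms by linarith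
      qed
      then have w2: "(w $ 2)\<^sup>2 \<le> \<sigma>\<^sup>2" using assms by (metis abs_le_square_iff abs_of_pos)
      have "(w $ 1)\<^sup>2 \<le> (1 - e) * 1" unfolding power2_eq_square
        using w w1 assms by (intro mult_mono) auto
      then have "(w $ 1)\<^sup>2 \<le> 1 - e" by simp
      moreover have "(w $ 2)\<^sup>2 / R ^ 4 \<le> \<sigma>\<^sup>2 / R ^ 4" using w2 by (intro divide_right_mono) auto
      ultimately have "(w $ 1)\<^sup>2 + (w $ 2)\<^sup>2 / R ^ 4 \<le> 1" using elim by linarith
      moreover have "r\<^sup>2 = R\<^sup>2 * ((w $ 1)\<^sup>2 + (w $ 2)\<^sup>2 / R ^ 4)"
        using elim w1 by (simp add: r_def q_def power_mult_distrib power_divide field_simps eval_nat_numeral)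
      ultimately have "r\<^sup>2 \<le> R\<^sup>2" using mult_left_le[of _ "R\<^sup>2"] by simp
      then have "r \<le> R" using power2_le_imp_le[of r R] elim by simp
      have "\<bar>arctan q\<bar> \<le> \<bar>q\<bar>" by (rule abs_arctan_le)
      also have "\<bar>q\<bar> < \<sigma> / R\<^sup>2"
        using w(2) w1 elim assms by (simp add: q_def abs_mult field_simps)
      finally have "\<bar>arctan q - 0\<bar> < \<sigma> / R\<^sup>2" by simp
      then have "vector [r * cos (arctan q), r * sin (arctan q)] \<in> wedge R 0 \<sigma>"
        unfolding mem_wedge_iff using \<open>r > 0\<close> \<open>r \<le> R\<close> by blast
      moreover have "geo (2 * ln R) *v vector [r * cos (arctan q), r * sin (arctan q)] = w"
        using elim w1 sq
        by (intro vec2_eqI)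
          (simp_all add: geo_log matrix_vector_mul_2x2_vector vector_2 cos_arctan sin_arctan r_def q_def power2_eq_square)
      ultimately show "w \<in> rescaled_wedge R \<sigma>" unfolding rescaled_wedge_def by force
    qed
  qed
qed

subsection \<open>Expanding circles\<close>

locale SL2R_configurations =
  fixes act :: "real^2^2 \<Rightarrow> 'a::metric_space \<Rightarrow> 'a" and \<Lambda> :: "'a \<Rightarrow> (real^2) set"
  assumes action: "continuous_SL2R_action act"
    and discrete: "discrete_config (\<Lambda> y)"
    and equivariant: "equivariant act \<Lambda>"
begin

lemma act_mult: "g \<in> carrier SL2R \<Longrightarrow> h \<in> carrier SL2R \<Longrightarrow> act (g ** h) y = act g (act h y)"
  using group_action.composition_rule[of SL2R UNIV act y g h] action
  by (simp add: continuous_SL2R_action_def)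

lemma act_one: "act (mat 1) y = y"
proof -
  have "act \<one>\<^bsub>SL2R\<^esub> = (\<lambda>x\<in>UNIV. x)"
    using group_action.id_eq_one[of SL2R UNIV act] action by (simp add: continuous_SL2R_action_def)
  then show ?thesis by (simp add: SL2R_def)
qed

lemma inverse_in_SL2R:
  assumes "g \<in> carrier SL2R"
  obtains h where "h \<in> carrier SL2R" "h ** g = mat 1" "g ** h = mat 1"
proof -
  have d: "det g = 1" using assms by (simp add: mem_SL2R)
  then have "invertible g" by (simp add: invertible_det_nz)
  then obtain h where h: "g ** h = mat 1" "h ** g = mat 1" by (auto simp: invertible_def)
  then have "det h * det g = 1" by (metis det_mul det_I)
  then show thesis using that h d by (simp add: mem_SL2R)
qed

lemma continuous_act_pair: "continuous_on (carrier SL2R \<times> UNIV) (\<lambda>(g, y). act g y)"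
  using action by (simp add: continuous_SL2R_action_def)

lemma continuous_act:
  assumes "g \<in> carrier SL2R"
  shows "continuous_on UNIV (act g)"
proof -
  have "continuous_on UNIV ((\<lambda>(g, y). act g y) \<circ> Pair g)"
    using assms by (intro continuous_on_compose continuous_on_subset[OF continuous_act_pair] continuous_intros) auto
  then show ?thesis by (simp add: o_def)
qed

lemma measurable_act: "g \<in> carrier SL2R \<Longrightarrow> act g \<in> borel_measurable borel"
  by (intro borel_measurable_continuous_onI continuous_act)

lemma compact_act_image: "g \<in> carrier SL2R \<Longrightarrow> compact K \<Longrightarrow> compact (act g ` K)"
  by (intro compact_continuous_image continuous_on_subset[OF continuous_act]) auto

text \<open>Group elements act by homeomorphisms, so the preimage is the image under the inverse
  element.\<close>

lemma compact_act_vimage: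
  assumes g: "g \<in> carrier SL2R" and K: "compact K"
  shows "compact (act g -` K)"
proof -
  obtain h where h: "h \<in> carrier SL2R" "h ** g = mat 1" "g ** h = mat 1"
    using inverse_in_SL2R[OF g] .
  have "act g -` K = act h ` K"
  proof (intro equalityI subsetI)
    fix y assume "y \<in> act g -` K"
    moreover have "y = act h (act g y)" using g h by (metis act_mult act_one)
    ultimately show "y \<in> act h ` K" by auto
  next
    fix y assume "y \<in> act h ` K"
    then show "y \<in> act g -` K" using g h by (auto simp: act_one simp flip: act_mult)
  qed
  then show ?thesis using compact_act_image[OF h(1) K] by simp
qed

lemma
  fixes f :: "'a \<Rightarrow> real"
  assumes g: "g \<in> carrier SL2R" and f: "continuous_on UNIV f" "has_compact_support f"
  shows continuous_comp_act: "continuous_on UNIV (\<lambda>y. f (act g y))"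
    and has_compact_support_comp_act: "has_compact_support (\<lambda>y. f (act g y))"
proof -
  show "continuous_on UNIV (\<lambda>y. f (act g y))"
    using continuous_on_compose2[OF f(1) continuous_act[OF g]] by simp
  let ?K = "closure {y. f y \<noteq> 0}"
  have K: "compact (act g -` ?K)"
    using compact_act_vimage[OF g] f(2) by (simp add: has_compact_support_def)
  have "{y. f (act g y) \<noteq> 0} \<subseteq> act g -` ?K" using closure_subset[of "{y. f y \<noteq> 0}"] by auto
  then have "closure {y. f (act g y) \<noteq> 0} \<subseteq> act g -` ?K"
    using K by (intro closure_minimal) (auto simp: compact_imp_closed)
  then show "has_compact_support (\<lambda>y. f (act g y))"
    unfolding has_compact_support_def using K by (metis closed_closure compact_Int_closed inf.absorb2)
qed

lemma config_act: "g \<in> carrier SL2R \<Longrightarrow> \<Lambda> (act g y) = (\<lambda>v. g *v v) ` \<Lambda> y"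
  using equivariant by (simp add: equivariant_def)

lemma finite_config_Int: "bounded W \<Longrightarrow> finite (\<Lambda> y \<inter> W)"
  using discrete[of y] by (simp add: discrete_config_def)

lemma zero_not_in_config: "0 \<notin> \<Lambda> y"
  using discrete[of y] by (simp add: discrete_config_def)

lemma inj_SL2R_vec: "g \<in> carrier SL2R \<Longrightarrow> inj (\<lambda>v. g *v v)"
  by (metis (no_types, lifting) inverse_in_SL2R injI matrix_vector_mul_assoc matrix_vector_mul_lid)

text \<open>The matrix straightens and rescales the wedge, and equivariance applies the same matrix
  to the configuration. As it is injective on the plane, the count is unchanged, and the dependence
  on \<open>\<theta>\<close> moves entirely into the point of the orbit.\<close>

lemma card_wedge_config:
  "card (wedge R \<theta> \<sigma> \<inter> \<Lambda> x)
    = card (\<Lambda> (act (geo (2 * ln R) ** rot (- \<theta>)) x) \<inter> rescaled_wedge R \<sigma>)"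
proof -
  let ?g = "geo (2 * ln R) ** rot (- \<theta>)"
  have g: "?g \<in> carrier SL2R" by (intro SL2R_mult geo_SL2R rot_SL2R)
  have "rescaled_wedge R \<sigma> = (\<lambda>v. ?g *v v) ` wedge R \<theta> \<sigma>"
  proof -
    have "rescaled_wedge R \<sigma> = (\<lambda>v. geo (2 * ln R) *v v) ` (\<lambda>v. rot (- \<theta>) *v v) ` wedge R \<theta> \<sigma>"
      using rot_image_wedge[of "- \<theta>" R \<theta> \<sigma>] by (simp add: rescaled_wedge_def)
    then show ?thesis by (simp add: image_image matrix_vector_mul_assoc)
  qed
  then have "\<Lambda> (act ?g x) \<inter> rescaled_wedge R \<sigma> = (\<lambda>v. ?g *v v) ` (wedge R \<theta> \<sigma> \<inter> \<Lambda> x)"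
    using image_Int[OF inj_SL2R_vec[OF g]] config_act[OF g] by (simp add: Int_commute)
  then show ?thesis using card_image[OF inj_on_subset[OF inj_SL2R_vec[OF g]]] by simp
qed

text \<open>Only the finitely many points of \<open>\<Lambda> x\<close> of norm at most
  \<open>R\<close> can enter a wedge, so the count is a finite sum of indicators of open sets of
  angles. Any predicate \<open>P\<close> is allowed because the count takes countably many
  values.\<close>

lemma sets_wedge_count: "{\<theta>. P (card (wedge R \<theta> \<sigma> \<inter> \<Lambda> x))} \<in> sets borel"
proof -
  define F where "F = \<Lambda> x \<inter> cball 0 R"
  have F: "finite F" unfolding F_def by (rule finite_config_Int) simp
  define c :: "real \<Rightarrow> real" where "c \<theta> = (\<Sum>v\<in>F. indicator {\<theta>. v \<in> wedge R \<theta> \<sigma>} \<theta>)" for \<theta>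
  have [measurable]: "{\<theta>. v \<in> wedge R \<theta> \<sigma>} \<in> sets borel" for v
    using open_wedge_angles by simp
  have [measurable]: "c \<in> borel_measurable borel" unfolding c_def[abs_def] by measurable
  have c: "c \<theta> = card (wedge R \<theta> \<sigma> \<inter> \<Lambda> x)" for \<theta>
  proof -
    have "wedge R \<theta> \<sigma> \<inter> \<Lambda> x = {v \<in> F. v \<in> wedge R \<theta> \<sigma>}" by (auto simp: F_def wedge_def)
    then show ?thesis using F by (simp add: c_def indicator_def sum.If_cases Int_def)
  qed
  have "{\<theta>. P (card (wedge R \<theta> \<sigma> \<inter> \<Lambda> x))} = (\<Union>i\<in>{i. P i}. c -` {real i} \<inter> space borel)"
    by (auto simp: c)
  also have "\<dots> \<in> sets borel" by (intro sets.countable_UN'' measurable_sets[of c borel borel]) auto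
  finally show ?thesis .
qed

lemma continuous_orbit: "continuous_on UNIV (\<lambda>\<theta>. act (geo t ** rot \<theta>) x)"
proof -
  have "continuous_on UNIV (\<lambda>\<theta>. (\<lambda>(g, y). act g y) (rot \<theta>, x))"
    by (rule continuous_on_compose2[OF continuous_act_pair])
      (auto intro!: continuous_intros continuous_rot rot_SL2R)
  then have "continuous_on UNIV (\<lambda>\<theta>. act (geo t) (act (rot \<theta>) x))"
    by (intro continuous_on_compose2[OF continuous_act[OF geo_SL2R]]) auto
  then show ?thesis by (simp add: act_mult geo_SL2R rot_SL2R)
qed

lemma measurable_orbit [measurable]: "(\<lambda>\<theta>. act (geo t ** rot \<theta>) x) \<in> borel_measurable borel"
  by (rule borel_measurable_continuous_onI[OF continuous_orbit])

lemma measurable_orbit_circle [measurable]: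
  "(\<lambda>\<theta>. act (geo t ** rot \<theta>) x) \<in> borel_measurable circle_measure"
  using measurable_orbit by (simp cong: measurable_cong_sets)

lemma prob_space_expanding_circle: "prob_space (expanding_circle act x R)"
  unfolding expanding_circle_def
  by (intro prob_space.prob_space_distr[OF prob_space_circle_measure] measurable_orbit_circle)

lemma sets_expanding_circle [simp, measurable_cong]: "sets (expanding_circle act x R) = sets borel"
  by (simp add: expanding_circle_def)

lemma space_expanding_circle [simp]: "space (expanding_circle act x R) = UNIV"
  by (simp add: expanding_circle_def)

lemma emeasure_expanding_circle:
  "B \<in> sets borel \<Longrightarrow> emeasure (expanding_circle act x R) B
     = emeasure circle_measure {\<theta>. act (geo (2 * ln R) ** rot \<theta>) x \<in> B}"
  unfolding expanding_circle_def by (subst emeasure_distr) (auto simp: vimage_def)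

lemma sets_orbit_vimage: "B \<in> sets borel \<Longrightarrow> {\<theta>. act (geo t ** rot \<theta>) x \<in> B} \<in> sets borel"
  using measurable_sets[OF measurable_orbit[of t x], of B] by (simp add: vimage_def)

lemma orbit_periodic:
  "\<theta> + 2 * pi \<in> {\<theta>. act (geo t ** rot \<theta>) x \<in> B} \<longleftrightarrow> \<theta> \<in> {\<theta>. act (geo t ** rot \<theta>) x \<in> B}"
  by (simp add: rot_periodic)

lemma measure_expanding_circle_reflect:
  assumes "B \<in> sets borel"
  shows "measure circle_measure {\<theta>. act (geo (2 * ln R) ** rot (- \<theta>)) x \<in> B}
     = measure (expanding_circle act x R) B"
  using emeasure_circle_reflect[OF sets_orbit_vimage[OF assms, of "2 * ln R" x] orbit_periodic]
    emeasure_expanding_circle[OF assms, of x R]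
  by (simp add: measure_def)

text \<open>The flow multiplies the radius by \<open>exp (s / 2)\<close>. It maps the family of
  circles to itself, and so leaves its limit invariant.\<close>

lemma distr_expanding_circle_geo:
  assumes "R > 0"
  shows "distr (expanding_circle act x R) borel (act (geo s)) = expanding_circle act x (R * exp (s / 2))"
proof -
  have "2 * ln (R * exp (s / 2)) = s + 2 * ln R" using assms by (simp add: ln_mult)
  moreover have "act (geo s) (act (geo t ** rot \<theta>) x) = act (geo (s + t) ** rot \<theta>) x" for t \<theta>
    by (simp add: act_mult SL2R_mult geo_SL2R rot_SL2R flip: geo_add)
  ultimately show ?thesis
    unfolding expanding_circle_def
    by (subst distr_distr) (auto simp: o_def measurable_act geo_SL2R)
qed

text \<open>On the expanded circle the conjugated rotation merely shifts the angle by
  \<open>c\<close>, which preserves \<open>circle_measure\<close>.\<close>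

lemma distr_expanding_circle_rot:
  assumes "0 \<le> c" "c \<le> 2 * pi"
  shows "distr (expanding_circle act x R) borel (act (geo (2 * ln R) ** rot c ** geo (- (2 * ln R))))
    = expanding_circle act x R"
proof (rule measure_eqI)
  let ?t = "2 * ln R"
  let ?m = "geo ?t ** rot c ** geo (- ?t)"
  have m: "?m \<in> carrier SL2R" by (intro SL2R_mult geo_SL2R rot_SL2R)
  have "?m ** (geo ?t ** rot \<theta>) = geo ?t ** rot (c + \<theta>)" for \<theta>
  proof -
    have "?m ** (geo ?t ** rot \<theta>) = geo ?t ** (rot c ** ((geo (- ?t) ** geo ?t) ** rot \<theta>))"
      by (simp only: matrix_mul_assoc)
    then show ?thesis by (simp add: geo_add geo_0 rot_add)
  qed
  then have shift: "act ?m (act (geo ?t ** rot \<theta>) x) = act (geo ?t ** rot (c + \<theta>)) x" for \<theta>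
    using act_mult[OF m SL2R_mult[OF geo_SL2R rot_SL2R], of ?t \<theta> x] by simp
  fix B assume "B \<in> sets (distr (expanding_circle act x R) borel (act ?m))"
  then have B: "B \<in> sets borel" by simp
  then have vB: "act ?m -` B \<in> sets borel"
    using measurable_sets[OF measurable_act[OF m], of B] by simp
  have "emeasure (distr (expanding_circle act x R) borel (act ?m)) B
      = emeasure (expanding_circle act x R) (act ?m -` B)"
    using B measurable_act[OF m] by (subst emeasure_distr) auto
  also have "\<dots> = emeasure circle_measure {\<theta>. c + \<theta> \<in> {\<theta>. act (geo ?t ** rot \<theta>) x \<in> B}}"
    using vB shift by (subst emeasure_expanding_circle) auto
  also have "\<dots> = emeasure circle_measure {\<theta>. act (geo ?t ** rot \<theta>) x \<in> B}"
    using assms by (intro emeasure_circle_shift sets_orbit_vimage[OF B] orbit_periodic)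
  finally show "emeasure (distr (expanding_circle act x R) borel (act ?m)) B
      = emeasure (expanding_circle act x R) B"
    using emeasure_expanding_circle[OF B] by simp
qed simp

end

subsection \<open>Radon probability measures\<close>

lemma integrable_indicator_borel:
  assumes "finite_measure M" "sets M = sets borel" "A \<in> sets borel"
  shows "integrable M (indicator A :: 'a::topological_space \<Rightarrow> real)"
proof -
  interpret finite_measure M by fact
  show ?thesis using assms by (intro integrable_real_indicator) (auto simp: emeasure_eq_measure)
qed

lemma radon_inner_regular:
  assumes \<nu>: "radon_probability \<nu>" and B: "B \<in> sets borel" and e: "e > 0"
  shows "\<exists>K. compact K \<and> K \<subseteq> B \<and> measure \<nu> K > measure \<nu> B - e"
proof (rule ccontr)
  interpret prob_space \<nu> using \<nu> by (simp add: radon_probability_def)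
  have sets: "sets \<nu> = sets borel" using \<nu> by (simp add: radon_probability_def)
  assume thesis: "\<not> ?thesis"
  then have le: "measure \<nu> K \<le> measure \<nu> B - e" if "compact K" "K \<subseteq> B" for K
    using that thesis by (meson not_le)
  have "0 \<le> measure \<nu> B - e" using le[of "{}"] by simp
  have "emeasure \<nu> B = (SUP K\<in>{K. K \<subseteq> B \<and> compact K}. emeasure \<nu> K)"
    using \<nu> B sets by (simp add: radon_probability_def)
  also have "\<dots> \<le> ennreal (measure \<nu> B - e)"
    by (rule SUP_least) (auto simp: emeasure_eq_measure intro!: ennreal_leI le)
  finally show False using e \<open>0 \<le> measure \<nu> B - e\<close> by (simp add: emeasure_eq_measure)
qed

text \<open>Inner regularity of \<open>- B\<close>, passed to complements.\<close>

lemma radon_outer_regular: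
  assumes \<nu>: "radon_probability \<nu>" and B: "B \<in> sets borel" and e: "e > 0"
  obtains U where "open U" "B \<subseteq> U" "measure \<nu> U < measure \<nu> B + e"
proof -
  interpret prob_space \<nu> using \<nu> by (simp add: radon_probability_def)
  have sets [simp]: "sets \<nu> = sets borel" using \<nu> by (simp add: radon_probability_def)
  have space: "space \<nu> = UNIV" using sets_eq_imp_space_eq[OF sets] by simp
  obtain L where L: "compact L" "L \<subseteq> - B" "measure \<nu> L > measure \<nu> (- B) - e"
    using radon_inner_regular[OF \<nu> _ e, of "- B"] B by auto
  have "measure \<nu> (- A) = 1 - measure \<nu> A" if "A \<in> sets borel" for A
    using prob_compl[of A] that by (simp add: space Compl_eq_Diff_UNIV)
  then have "measure \<nu> (- L) < measure \<nu> B + e" using L B by (simp add: borel_compact)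
  then show thesis using that[of "- L"] L by (auto simp: compact_imp_closed open_Compl)
qed

text \<open>The open-set half of the portmanteau theorem. Inner regularity puts nearly all the
  measure of \<open>U\<close> on a compact \<open>K\<close>, and a compactly supported function lies
  between the indicators of \<open>K\<close> and \<open>U\<close>, so testing against such functions
  yields the lower bound.\<close>

lemma weak_star_liminf_open:
  fixes \<nu> :: "'a::metric_space measure"
  assumes lc: "locally_compact_space (euclidean :: 'a topology)"
    and \<nu>: "radon_probability \<nu>" and ws: "weak_star_tendsto \<mu> \<nu> F"
    and \<mu>: "\<And>i. prob_space (\<mu> i)" "\<And>i. sets (\<mu> i) = sets borel"
    and U: "open U" and e: "e > 0"
  shows "\<forall>\<^sub>F i in F. measure (\<mu> i) U > measure \<nu> U - e"
proof -
  interpret prob_space \<nu> using \<nu> by (simp add: radon_probability_def)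
  have sets [simp]: "sets \<nu> = sets borel" using \<nu> by (simp add: radon_probability_def)
  obtain K where K: "compact K" "K \<subseteq> U" "measure \<nu> K > measure \<nu> U - e"
    using radon_inner_regular[OF \<nu> _ e, of U] U by auto
  obtain f where f: "continuous_on UNIV f" "has_compact_support f" "\<And>y. 0 \<le> f y" "\<And>y. f y \<le> 1"
      "\<And>y. y \<in> K \<Longrightarrow> f y = 1" "\<And>y. y \<notin> U \<Longrightarrow> f y = (0::real)"
    using Urysohn_compact_support[OF lc K(1) U K(2)] by blast
  have "measure \<nu> K = (\<integral>y. indicator K y \<partial>\<nu>)" using K(1) by (simp add: borel_compact)
  also have "\<dots> \<le> (\<integral>y. f y \<partial>\<nu>)"
    using f K(1)
    by (intro integral_mono integrable_compact_support integrable_indicator_borel)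
      (auto simp: indicator_def borel_compact finite_measure_axioms)
  finally have "(\<integral>y. f y \<partial>\<nu>) > measure \<nu> U - e" using K(3) by simp
  then have "\<forall>\<^sub>F i in F. (\<integral>y. f y \<partial>\<mu> i) > measure \<nu> U - e"
    using ws f(1,2) by (intro order_tendstoD(1)) (auto simp: weak_star_tendsto_def)
  then show ?thesis
  proof eventually_elim
    case (elim i)
    interpret M: prob_space "\<mu> i" by (rule \<mu>)
    have "(\<integral>y. f y \<partial>\<mu> i) \<le> (\<integral>y. indicator U y \<partial>\<mu> i)"
      using f U
      by (intro integral_mono integrable_compact_support integrable_indicator_borel)
        (auto simp: \<mu> indicator_def M.finite_measure_axioms)
    also have "\<dots> = measure (\<mu> i) U" using U by (simp add: \<mu>)
    finally show ?case using elim by simp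
  qed
qed

subsection \<open>Invariance of the limit measure\<close>

locale equidistributing_circles = SL2R_configurations act \<Lambda>
  for act :: "real^2^2 \<Rightarrow> 'a::metric_space \<Rightarrow> 'a" and \<Lambda> :: "'a \<Rightarrow> (real^2) set" +
  fixes x :: 'a and \<nu> :: "'a measure"
  assumes locally_compact: "locally_compact_space (euclidean :: 'a topology)"
    and radon: "radon_probability \<nu>"
    and AE_vaguely_continuous: "AE y in \<nu>. vaguely_continuous_at \<Lambda> y"
    and weak_star: "weak_star_tendsto (expanding_circle act x) \<nu> at_top"
begin

sublocale prob_space \<nu>
  using radon by (simp add: radon_probability_def)

lemma sets_limit [simp, measurable_cong]: "sets \<nu> = sets borel"
  using radon by (simp add: radon_probability_def)

lemma space_limit [simp]: "space \<nu> = UNIV"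
  using sets_eq_imp_space_eq[OF sets_limit] by simp

text \<open>For large \<open>R\<close> the functions \<open>f \<circ> act g\<close> and
  \<open>f \<circ> act (m R)\<close> are close on a compact set outside which the first vanishes;
  there \<open>f \<ge> 0\<close> gives the inequality at once. Since \<open>act (m R)\<close> takes
  the circle at \<open>R\<close> to the one at \<open>\<rho> R\<close>, letting \<open>R\<close>
  tend to infinity on both sides compares the two integrals against \<open>\<nu>\<close>.\<close>

lemma integral_subinvariant:
  fixes f :: "'a \<Rightarrow> real"
  assumes g: "g \<in> carrier SL2R" and m: "\<And>R. m R \<in> carrier SL2R" "(m \<longlongrightarrow> g) at_top"
    and \<rho>: "filterlim \<rho> at_top at_top"
    and distr: "\<forall>\<^sub>F R in at_top.
      distr (expanding_circle act x R) borel (act (m R)) = expanding_circle act x (\<rho> R)"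
    and f: "continuous_on UNIV f" "has_compact_support f" "\<And>y. 0 \<le> f y"
  shows "(\<integral>y. f (act g y) \<partial>\<nu>) \<le> (\<integral>y. f y \<partial>\<nu>)"
proof (rule field_le_epsilon)
  fix e :: real assume e: "e > 0"
  let ?\<mu> = "expanding_circle act x"
  let ?K = "closure {y. f y \<noteq> 0}"
  \<comment> \<open>\<open>L\<close> contains every point where \<open>f \<circ> act g\<close> is
    nonzero, and \<open>D\<close> is a compact set of matrices in \<open>carrier SL2R\<close> that
    eventually contains \<open>m R\<close>. Uniform continuity is used on their product.\<close>
  define L where "L = act g -` ?K"
  have L: "compact L" unfolding L_def using f(2) g
    by (intro compact_act_vimage) (simp_all add: has_compact_support_def)
  define D where "D = cball g 1 \<inter> carrier SL2R"
  have "closed (carrier SL2R)"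
    unfolding SL2R_def by (auto simp: det_2 intro!: closed_Collect_eq continuous_intros)
  then have D: "compact D" unfolding D_def by (intro compact_Int_closed) auto
  have "continuous_on (D \<times> L) (\<lambda>p. f ((\<lambda>(h, y). act h y) p))"
    by (rule continuous_on_compose2[OF f(1)])
      (auto intro: continuous_on_subset[OF continuous_act_pair] simp: D_def)
  then have "uniformly_continuous_on (D \<times> L) (\<lambda>p. f ((\<lambda>(h, y). act h y) p))"
    using D L by (intro compact_uniformly_continuous compact_Times)
  then obtain d where d: "d > 0" and unif: "\<And>p q. p \<in> D \<times> L \<Longrightarrow> q \<in> D \<times> L \<Longrightarrow> dist q p < d \<Longrightarrow>
      dist (f ((\<lambda>(h, y). act h y) q)) (f ((\<lambda>(h, y). act h y) p)) < e"
    using e unfolding uniformly_continuous_on_def by meson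
  have "\<forall>\<^sub>F R in at_top. dist (m R) g < min d 1" using m(2) d by (intro tendstoD) auto
  then have ev: "\<forall>\<^sub>F R in at_top. (\<integral>y. f (act g y) \<partial>?\<mu> R) \<le> (\<integral>y. f y \<partial>?\<mu> (\<rho> R)) + e"
    using distr
  proof eventually_elim
    case (elim R)
    have le: "f (act g y) \<le> f (act (m R) y) + e" for y
    proof (cases "y \<in> L")
      case True
      have "dist (g, y) (m R, y) < d" using elim(1) by (simp add: dist_Pair_Pair dist_commute)
      moreover have "(g, y) \<in> D \<times> L" "(m R, y) \<in> D \<times> L"
        using True g m(1) elim(1) by (auto simp: D_def dist_commute)
      ultimately show ?thesis using unif[of "(m R, y)" "(g, y)"] by (auto simp: dist_real_def)
    next
      case False
      then have "f (act g y) = 0" using closure_subset[of "{y. f y \<noteq> 0}"] by (auto simp: L_def)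
      then show ?thesis using f(3)[of "act (m R) y"] e by simp
    qed
    interpret M: prob_space "?\<mu> R" by (rule prob_space_expanding_circle)
    have int: "integrable (?\<mu> R) (\<lambda>y. f (act h y))" if "h \<in> carrier SL2R" for h
      using continuous_comp_act[OF that f(1,2)] has_compact_support_comp_act[OF that f(1,2)]
      by (intro integrable_compact_support) (auto simp: M.finite_measure_axioms)
    have "(\<integral>y. f (act g y) \<partial>?\<mu> R) \<le> (\<integral>y. f (act (m R) y) + e \<partial>?\<mu> R)"
      using le int g m(1) by (intro integral_mono) auto
    also have "\<dots> = (\<integral>y. f (act (m R) y) \<partial>?\<mu> R) + e"
      using int[OF m(1)] M.prob_space by simp
    also have "(\<integral>y. f (act (m R) y) \<partial>?\<mu> R) = (\<integral>y. f y \<partial>distr (?\<mu> R) borel (act (m R)))"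
      using measurable_act[OF m(1)] borel_measurable_continuous_onI[OF f(1)]
      by (subst integral_distr) (auto cong: measurable_cong_sets)
    finally show ?case using elim(2) by simp
  qed
  have 1: "((\<lambda>R. \<integral>y. f (act g y) \<partial>?\<mu> R) \<longlongrightarrow> (\<integral>y. f (act g y) \<partial>\<nu>)) at_top"
    using weak_star continuous_comp_act[OF g f(1,2)] has_compact_support_comp_act[OF g f(1,2)]
    by (simp add: weak_star_tendsto_def)
  have "((\<lambda>R. \<integral>y. f y \<partial>?\<mu> R) \<longlongrightarrow> (\<integral>y. f y \<partial>\<nu>)) at_top"
    using weak_star f(1,2) by (simp add: weak_star_tendsto_def)
  from filterlim_compose[OF this \<rho>]
  have 2: "((\<lambda>R. (\<integral>y. f y \<partial>?\<mu> (\<rho> R)) + e) \<longlongrightarrow> (\<integral>y. f y \<partial>\<nu>) + e) at_top"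
    by (intro tendsto_intros)
  show "(\<integral>y. f (act g y) \<partial>\<nu>) \<le> (\<integral>y. f y \<partial>\<nu>) + e"
    by (rule tendsto_le[OF _ 2 1 ev]) simp
qed

lemma measure_compact_image_ge:
  assumes g: "g \<in> carrier SL2R" and m: "\<And>R. m R \<in> carrier SL2R" "(m \<longlongrightarrow> g) at_top"
    and \<rho>: "filterlim \<rho> at_top at_top"
    and distr: "\<forall>\<^sub>F R in at_top.
      distr (expanding_circle act x R) borel (act (m R)) = expanding_circle act x (\<rho> R)"
    and K: "compact K"
  shows "measure \<nu> K \<le> measure \<nu> (act g ` K)"
proof (rule field_le_epsilon)
  fix e :: real assume e: "e > 0"
  have gK: "compact (act g ` K)" using g K by (rule compact_act_image)
  obtain U where U: "open U" "act g ` K \<subseteq> U" "measure \<nu> U < measure \<nu> (act g ` K) + e"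
    using radon_outer_regular[OF radon _ e] borel_compact[OF gK] by blast
  obtain f where f: "continuous_on UNIV f" "has_compact_support f" "\<And>y. 0 \<le> f y" "\<And>y. f y \<le> 1"
      "\<And>y. y \<in> act g ` K \<Longrightarrow> f y = 1" "\<And>y. y \<notin> U \<Longrightarrow> f y = (0::real)"
    using Urysohn_compact_support[OF locally_compact gK U(1,2)] by blast
  have "measure \<nu> K = (\<integral>y. indicator K y \<partial>\<nu>)" using K by (simp add: borel_compact)
  also have "\<dots> \<le> (\<integral>y. f (act g y) \<partial>\<nu>)"
    using f K continuous_comp_act[OF g f(1,2)] has_compact_support_comp_act[OF g f(1,2)]
    by (intro integral_mono integrable_compact_support integrable_indicator_borel)
      (auto simp: indicator_def borel_compact finite_measure_axioms)
  also have "\<dots> \<le> (\<integral>y. f y \<partial>\<nu>)"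
    by (rule integral_subinvariant[OF g m \<rho> distr f(1,2,3)])
  also have "\<dots> \<le> (\<integral>y. indicator U y \<partial>\<nu>)"
    using f U by (intro integral_mono integrable_compact_support integrable_indicator_borel)
      (auto simp: indicator_def finite_measure_axioms)
  also have "\<dots> = measure \<nu> U" using U by simp
  finally show "measure \<nu> K \<le> measure \<nu> (act g ` K) + e" using U(3) by simp
qed

lemma measure_compact_geo_image_ge:
  assumes "compact K"
  shows "measure \<nu> K \<le> measure \<nu> (act (geo s) ` K)"
proof (rule measure_compact_image_ge[where m = "\<lambda>_. geo s" and \<rho> = "\<lambda>R. R * exp (s / 2)"])
  show "filterlim (\<lambda>R. R * exp (s / 2)) at_top at_top"
    by (rule filterlim_at_top_mult_tendsto_pos[OF tendsto_const exp_gt_zero filterlim_ident])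
  show "\<forall>\<^sub>F R in at_top. distr (expanding_circle act x R) borel (act (geo s))
      = expanding_circle act x (R * exp (s / 2))"
    using eventually_gt_at_top[of 0] by eventually_elim (rule distr_expanding_circle_geo)
qed (use assms geo_SL2R in auto)

text \<open>The conjugated rotations approximating the shear fix each expanding circle, so
  \<open>\<rho>\<close> is the identity. The assumption \<open>s \<ge> 0\<close> puts the angle
  \<open>s / R\<^sup>2\<close> eventually in the range from 0 to \<open>2 * pi\<close> covered by
  \<open>distr_expanding_circle_rot\<close>.\<close>

lemma measure_compact_shear_image_ge:
  assumes K: "compact K" and s: "s \<ge> 0"
  shows "measure \<nu> K \<le> measure \<nu> (act (shear s) ` K)"
proof (rule measure_compact_image_ge[where \<rho> = "\<lambda>R. R", OF shear_SL2R _ geo_rot_geo_tendsto_shear _ _ K])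
  have "((\<lambda>R. s / R\<^sup>2) \<longlongrightarrow> 0) at_top" by real_asymp
  then have "\<forall>\<^sub>F R in at_top. s / R\<^sup>2 < 2 * pi" by (intro order_tendstoD(2)) auto
  then show "\<forall>\<^sub>F R in at_top. distr (expanding_circle act x R) borel
      (act (geo (2 * ln R) ** rot (s / R\<^sup>2) ** geo (- (2 * ln R)))) = expanding_circle act x R"
    by eventually_elim (use s in \<open>intro distr_expanding_circle_rot, auto\<close>)
qed (auto intro: SL2R_mult geo_SL2R rot_SL2R filterlim_ident)

section \<open>Configurations almost surely avoid the sides of the triangle\<close>

text \<open>
  If the compact set \<open>E\<close> were met with positive probability, so would be all the disjoint
  sets \<open>g n ` E\<close>, with probabilities bounded below; then infinitely many of them would be
  met at once, against local finiteness.
\<close>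
lemma AE_config_avoids:
  fixes g :: "nat \<Rightarrow> real^2^2"
  assumes E: "compact E" and g: "\<And>n. g n \<in> carrier SL2R"
    and inv: "\<And>n K. compact K \<Longrightarrow> measure \<nu> K \<le> measure \<nu> (act (g n) ` K)"
    and bdd: "\<And>n v. v \<in> E \<Longrightarrow> norm (g n *v v) \<le> b"
    and disj: "\<And>m n v w. v \<in> E \<Longrightarrow> w \<in> E \<Longrightarrow> g m *v v = g n *v w \<Longrightarrow> g m *v v \<noteq> 0 \<Longrightarrow> m = n"
  shows "AE y in \<nu>. \<Lambda> y \<inter> E = {}"
proof -
  obtain N where N: "N \<in> null_sets \<nu>" "\<And>y. y \<notin> N \<Longrightarrow> vaguely_continuous_at \<Lambda> y"
    using AE_vaguely_continuous by (auto simp: eventually_ae_filter)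
  \<comment> \<open>The event that \<open>\<Lambda> y\<close> meets \<open>E\<close> need not be
    Borel. Removing the open set \<open>W\<close> and the null set \<open>N\<close> leaves a Borel
    set \<open>B\<close>; at a point of vague continuity, avoiding the compact \<open>E\<close> is
    an open condition, so every point of \<open>B\<close> does meet \<open>E\<close>.\<close>
  define W where "W = interior {y. \<Lambda> y \<inter> E = {}}"
  define B where "B = - N - W"
  have [measurable]: "N \<in> sets borel" using N by auto
  have B: "B \<in> sets borel" unfolding B_def W_def by auto
  have meets: "\<Lambda> y \<inter> E \<noteq> {}" if "y \<in> B" for y
  proof
    assume empty: "\<Lambda> y \<inter> E = {}"
    obtain c where c: "E \<subseteq> ball 0 c" using compact_imp_bounded[OF E] bounded_subset_ballD by blast
    \<comment> \<open>Deleting the finitely many points of \<open>\<Lambda> y\<close> from the ball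
      leaves an open set around \<open>E\<close> free of such points, so
      \<open>card_locally_constant\<close> applies with count 0 and empty inner set.\<close>
    define V where "V = ball 0 c - \<Lambda> y \<inter> ball 0 c"
    have fin: "finite (\<Lambda> y \<inter> ball 0 c)" by (rule finite_config_Int) simp
    have "\<forall>\<^sub>F z in nhds y. \<forall>S. {} \<subseteq> S \<longrightarrow> S \<subseteq> E \<longrightarrow> card (\<Lambda> z \<inter> S) = card (\<Lambda> y \<inter> V)"
    proof (rule card_locally_constant[OF discrete])
      show "vaguely_continuous_at \<Lambda> y" using that N(2) by (simp add: B_def)
      show "open V" unfolding V_def using fin by (intro open_Diff finite_imp_closed) auto
      show "bounded V" unfolding V_def by (rule bounded_subset[OF bounded_ball[of 0 c]]) auto
      show "E \<subseteq> V" using c empty by (auto simp: V_def)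
      show "\<Lambda> y \<inter> V \<subseteq> {}" by (auto simp: V_def)
    qed (use E in auto)
    then have "\<forall>\<^sub>F z in nhds y. \<Lambda> z \<inter> E = {}"
    proof eventually_elim
      case (elim z)
      have "\<Lambda> y \<inter> V = {}" by (auto simp: V_def)
      then have "card (\<Lambda> z \<inter> E) = 0" using elim by simp
      then show ?case using finite_config_Int[OF compact_imp_bounded[OF E]] by simp
    qed
    then have "y \<in> W" unfolding W_def eventually_nhds interior_def by blast
    then show False using that by (simp add: B_def)
  qed
  have "measure \<nu> B = 0"
  proof (rule ccontr)
    assume "measure \<nu> B \<noteq> 0"
    then have pos: "measure \<nu> B > 0" by (simp add: zero_less_measure_iff)
    obtain K where K: "compact K" "K \<subseteq> B" "measure \<nu> K > measure \<nu> B - measure \<nu> B"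
      using radon_inner_regular[OF radon B pos] by blast
    define M where "M n = (\<Union>k\<in>{n..}. act (g k) ` K)" for n
    have sets_image: "act (g k) ` K \<in> sets borel" for k
      by (intro borel_compact compact_act_image g K)
    then have sets_M: "M n \<in> sets borel" for n
      unfolding M_def by (intro sets.countable_UN'') auto
    have "decseq M" unfolding M_def decseq_def by (intro allI impI UN_mono) auto
    then have "(\<lambda>n. measure \<nu> (M n)) \<longlonglongrightarrow> measure \<nu> (\<Inter>n. M n)"
      using sets_M by (intro finite_Lim_measure_decseq) auto
    moreover have "measure \<nu> K \<le> measure \<nu> (M n)" for n
    proof -
      have "measure \<nu> K \<le> measure \<nu> (act (g n) ` K)" by (rule inv[OF K(1)])
      also have "\<dots> \<le> measure \<nu> (M n)"
        using sets_M sets_image by (intro finite_measure_mono) (auto simp: M_def)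
      finally show ?thesis .
    qed
    ultimately have "measure \<nu> K \<le> measure \<nu> (\<Inter>n. M n)"
      by (intro LIMSEQ_le_const[of "\<lambda>n. measure \<nu> (M n)"]) auto
    then have "(\<Inter>n. M n) \<noteq> {}" using K(3) by auto
    then obtain y where y: "\<And>n. y \<in> M n" by auto
    define I where "I = {n. y \<in> act (g n) ` K}"
    have "\<exists>n\<ge>m. n \<in> I" for m using y[of m] unfolding I_def M_def by blast
    then have "infinite I" unfolding infinite_nat_iff_unbounded_le by blast
    have "\<exists>v\<in>E. g n *v v \<in> \<Lambda> y" if "n \<in> I" for n
    proof -
      obtain k where k: "k \<in> K" "y = act (g n) k" using \<open>n \<in> I\<close> unfolding I_def by blast
      then obtain v where "v \<in> \<Lambda> k" "v \<in> E" using meets K(2) by blast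
      then show ?thesis using k(2) config_act[OF g, of n k] by auto
    qed
    then obtain v where v: "\<And>n. n \<in> I \<Longrightarrow> v n \<in> E" "\<And>n. n \<in> I \<Longrightarrow> g n *v v n \<in> \<Lambda> y" by metis
    \<comment> \<open>The assumption \<open>disj\<close> permits the images of \<open>E\<close> to
      share the origin, which no configuration contains.\<close>
    have "inj_on (\<lambda>n. g n *v v n) I"
      by (rule inj_onI) (metis disj v zero_not_in_config)
    moreover have "(\<lambda>n. g n *v v n) ` I \<subseteq> \<Lambda> y \<inter> cball 0 b" using v bdd by auto
    then have "finite ((\<lambda>n. g n *v v n) ` I)"
      by (rule finite_subset) (rule finite_config_Int, simp)
    ultimately show False using \<open>infinite I\<close> finite_imageD by blast
  qed
  then have "B \<in> null_sets \<nu>" using B by (simp add: null_sets_def emeasure_eq_measure)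
  then have "B \<union> N \<in> null_sets \<nu>" using N(1) by auto
  then show ?thesis
  proof (rule AE_I')
    show "{y \<in> space \<nu>. \<Lambda> y \<inter> E \<noteq> {}} \<subseteq> B \<union> N"
      using interior_subset[of "{y. \<Lambda> y \<inter> E = {}}"] by (auto simp: B_def W_def)
  qed
qed

end

lemma vec2_bound: "\<bar>v $ 1\<bar> \<le> a \<Longrightarrow> \<bar>v $ 2\<bar> \<le> b \<Longrightarrow> norm (v :: real^2) \<le> a + b"
  using norm_le_l1_cart[of v] by (simp add: sum_2)

context equidistributing_circles
begin

text \<open>A shear by \<open>s\<close> changes the slope from \<open>c\<close> to
  \<open>s + c\<close> and keeps the first coordinate. The distinct parameters
  \<open>1 / Suc n\<close> give segments meeting only at the origin, and parameters at most 1 keep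
  them in a common ball.\<close>

lemma AE_config_avoids_ray: "AE y in \<nu>. \<Lambda> y \<inter> {v. v $ 2 = c * v $ 1 \<and> \<bar>v $ 1\<bar> \<le> 1} = {}"
proof (rule AE_config_avoids[where g = "\<lambda>n. shear (1 / Suc n)" and b = "1 + (\<bar>c\<bar> + 1)"])
  let ?E = "{v :: real^2. v $ 2 = c * v $ 1 \<and> \<bar>v $ 1\<bar> \<le> 1}"
  have shear: "shear s *v v = vector [v $ 1, (s + c) * v $ 1]" if "v \<in> ?E" for s v
    using that by (simp add: shear_def matrix_vector_mul_2x2_vector algebra_simps)
  have bound: "norm (shear s *v v) \<le> 1 + (\<bar>c\<bar> + 1)" if "v \<in> ?E" "0 \<le> s" "s \<le> 1" for s v
  proof (rule vec2_bound)
    have "\<bar>(s + c) * v $ 1\<bar> \<le> (\<bar>c\<bar> + 1) * 1"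
      unfolding abs_mult using that by (intro mult_mono) auto
    then show "\<bar>(shear s *v v) $ 2\<bar> \<le> \<bar>c\<bar> + 1" using shear[OF that(1)] by (simp add: vector_2)
    show "\<bar>(shear s *v v) $ 1\<bar> \<le> 1" using shear[OF that(1)] that by (simp add: vector_2)
  qed
  have "closed ?E" by (intro closed_Collect_conj closed_Collect_eq closed_Collect_le continuous_intros)
  moreover have "?E \<subseteq> cball 0 (1 + \<bar>c\<bar>)"
  proof
    fix v assume "v \<in> ?E"
    moreover from this have "\<bar>c\<bar> * \<bar>v $ 1\<bar> \<le> \<bar>c\<bar> * 1" by (intro mult_left_mono) auto
    ultimately show "v \<in> cball 0 (1 + \<bar>c\<bar>)" using vec2_bound[of v 1 "\<bar>c\<bar>"] by (auto simp: abs_mult)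
  qed
  then have "bounded ?E" using bounded_cball bounded_subset by blast
  ultimately show "compact ?E" by (simp add: compact_eq_bounded_closed)
  show "norm (shear (1 / Suc n) *v v) \<le> 1 + (\<bar>c\<bar> + 1)" if "v \<in> ?E" for n v
    by (rule bound[OF that]) auto
  show "m = n" if "v \<in> ?E" "w \<in> ?E" "shear (1 / Suc m) *v v = shear (1 / Suc n) *v w"
      "shear (1 / Suc m) *v v \<noteq> 0" for m n v w
  proof -
    have eq: "vector [v $ 1, (1 / Suc m + c) * v $ 1] = (vector [w $ 1, (1 / Suc n + c) * w $ 1] :: real^2)"
      using that(3) shear[OF that(1)] shear[OF that(2)] by simp
    then have 1: "v $ 1 = w $ 1" by (metis vector_2(1))
    have 2: "(1 / Suc m + c) * v $ 1 = (1 / Suc n + c) * w $ 1" using eq by (metis vector_2(2))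
    have "v $ 1 \<noteq> 0"
    proof
      assume "v $ 1 = 0"
      then have "shear (1 / Suc m) *v v = 0"
        unfolding shear[OF that(1)] by (intro vec2_eqI) (simp_all add: vector_2)
      then show False using that(4) by simp
    qed
    then have "1 / real (Suc m) = 1 / real (Suc n)" using 1 2 by simp
    then show "m = n" by simp
  qed
qed (auto intro: shear_SL2R measure_compact_shear_image_ge)

text \<open>The flow moves the line \<open>v $ 1 = 1\<close> to
  \<open>v $ 1 = exp (- t / 2)\<close>, so distinct times give disjoint segments. Times at most 1
  stretch the second coordinate by at most \<open>exp (1 / 2)\<close>.\<close>

lemma AE_config_avoids_vertical: "AE y in \<nu>. \<Lambda> y \<inter> {v. v $ 1 = 1 \<and> \<bar>v $ 2\<bar> \<le> c} = {}"
proof (rule AE_config_avoids[where g = "\<lambda>n. geo (1 / Suc n)" and b = "1 + exp (1 / 2) * c"])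
  let ?E = "{v :: real^2. v $ 1 = 1 \<and> \<bar>v $ 2\<bar> \<le> c}"
  have geo: "geo t *v v = vector [exp (- t / 2), exp (t / 2) * v $ 2]" if "v \<in> ?E" for t v
    using that by (simp add: geo_def matrix_vector_mul_2x2_vector)
  have bound: "norm (geo t *v v) \<le> 1 + exp (1 / 2) * c" if "v \<in> ?E" "0 \<le> t" "t \<le> 1" for t v
  proof (rule vec2_bound)
    have "\<bar>exp (t / 2) * v $ 2\<bar> \<le> exp (1 / 2) * c"
      unfolding abs_mult using that by (intro mult_mono) auto
    then show "\<bar>(geo t *v v) $ 2\<bar> \<le> exp (1 / 2) * c" using geo[OF that(1)] by (simp add: vector_2)
    show "\<bar>(geo t *v v) $ 1\<bar> \<le> 1" using geo[OF that(1)] that by (simp add: vector_2)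
  qed
  have "closed ?E" by (intro closed_Collect_conj closed_Collect_eq closed_Collect_le continuous_intros)
  moreover have "?E \<subseteq> cball 0 (1 + c)" using vec2_bound[of _ 1 c] by auto
  then have "bounded ?E" using bounded_cball bounded_subset by blast
  ultimately show "compact ?E" by (simp add: compact_eq_bounded_closed)
  show "norm (geo (1 / Suc n) *v v) \<le> 1 + exp (1 / 2) * c" if "v \<in> ?E" for n v
    by (rule bound[OF that]) auto
  show "m = n" if "v \<in> ?E" "w \<in> ?E" "geo (1 / Suc m) *v v = geo (1 / Suc n) *v w" for m n v w
  proof -
    have "exp (- (1 / real (Suc m)) / 2) = exp (- (1 / real (Suc n)) / 2)"
      using that(3) geo[OF that(1)] geo[OF that(2)] by (metis vector_2(1))
    then have "1 / real (Suc m) = 1 / real (Suc n)" unfolding exp_inj_iff by simp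
    then show "m = n" by simp
  qed
qed (auto intro: geo_SL2R measure_compact_geo_image_ge)

section \<open>From almost sure avoidance of the sides to convergence of the counts\<close>

lemma AE_config_avoids_frontier:
  assumes "\<sigma> > 0"
  shows "AE y in \<nu>. \<forall>v\<in>\<Lambda> y. triangle_depth \<sigma> v \<noteq> 0"
  using AE_config_avoids_ray[of \<sigma>] AE_config_avoids_ray[of "- \<sigma>"] AE_config_avoids_vertical[of \<sigma>]
proof eventually_elim
  case (elim y)
  show ?case
  proof
    fix v assume v: "v \<in> \<Lambda> y"
    show "triangle_depth \<sigma> v \<noteq> 0"
    proof
      assume "triangle_depth \<sigma> v = 0"
      then consider "v $ 1 = 1" "\<bar>v $ 2\<bar> \<le> \<sigma> * v $ 1" | "\<bar>v $ 2\<bar> = \<sigma> * v $ 1" "v $ 1 \<le> 1"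
        by (auto simp: triangle_depth_def min_def split: if_splits)
      then show False
      proof cases
        case 1
        then show ?thesis using v elim(3) by auto
      next
        case 2
        have "0 \<le> \<sigma> * v $ 1" using 2(1) abs_ge_zero[of "v $ 2"] by linarith
        then have "\<bar>v $ 1\<bar> \<le> 1" using assms 2(2) by (simp add: zero_le_mult_iff)
        moreover have "v $ 2 = \<sigma> * v $ 1 \<or> v $ 2 = - \<sigma> * v $ 1" using 2(1) by (simp add: abs_if split: if_splits)
        ultimately show ?thesis using v elim(1,2) by blast
      qed
    qed
  qed
qed

text \<open>The interior makes the set open, so that it is Borel and
  \<open>weak_star_liminf_open\<close> applies. Imposing \<open>P\<close> for the triangle and for
  all \<open>R \<ge> real n\<close> together makes one set a lower approximation of both the
  limiting event and the wedge events.\<close>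

definition stable_count :: "real \<Rightarrow> (nat \<Rightarrow> bool) \<Rightarrow> nat \<Rightarrow> 'a set" where
  "stable_count \<sigma> P n = interior {z. P (card (\<Lambda> z \<inter> thinning_triangle \<sigma>)) \<and>
     (\<forall>R\<ge>real n. P (card (\<Lambda> z \<inter> rescaled_wedge R \<sigma>)))}"

lemma open_stable_count: "open (stable_count \<sigma> P n)"
  by (simp add: stable_count_def)

lemma incseq_stable_count: "incseq (stable_count \<sigma> P)"
  unfolding incseq_def stable_count_def by (intro allI impI interior_mono) force

lemma stable_count_subset:
  "stable_count \<sigma> P n \<subseteq> {z. P (card (\<Lambda> z \<inter> thinning_triangle \<sigma>)) \<and>
     (\<forall>R\<ge>real n. P (card (\<Lambda> z \<inter> rescaled_wedge R \<sigma>)))}"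
  unfolding stable_count_def by (rule interior_subset)

text \<open>Only finitely many points of \<open>\<Lambda> y\<close> lie near the triangle, and none
  on its sides, so their depths keep away from 0. The triangle and all rescaled wedges of large
  \<open>R\<close> lie between \<open>{v. ?d v > e}\<close> and \<open>{v. ?d v \<ge> - e}\<close>,
  and \<open>card_locally_constant\<close> handles them all with one neighbourhood of
  \<open>y\<close>.\<close>

lemma mem_stable_count:
  assumes \<sigma>: "\<sigma> > 0" and vc: "vaguely_continuous_at \<Lambda> y"
    and frontier: "\<forall>v\<in>\<Lambda> y. triangle_depth \<sigma> v \<noteq> 0"
    and P: "P (card (\<Lambda> y \<inter> thinning_triangle \<sigma>))"
  shows "\<exists>n. y \<in> stable_count \<sigma> P n"
proof -
  let ?d = "triangle_depth \<sigma>"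
  have cont: "continuous_on UNIV ?d" by (rule continuous_triangle_depth)
  define F where "F = \<Lambda> y \<inter> {v. ?d v \<ge> - 1}"
  have F: "finite F" unfolding F_def by (intro finite_config_Int bounded_triangle_depth \<sigma>)
  \<comment> \<open>Inserting 1 keeps the minimum defined when \<open>F\<close> is empty and yields
    \<open>3 * e \<le> 1\<close>, so every configuration point of depth above
    \<open>- (2 * e)\<close> belongs to \<open>F\<close>. The factor 3 then excludes depths between
    \<open>- (2 * e)\<close> and \<open>e\<close>.\<close>
  define e where "e = Min (insert 1 ((\<lambda>v. \<bar>?d v\<bar>) ` F)) / 3"
  have "Min (insert 1 ((\<lambda>v. \<bar>?d v\<bar>) ` F)) > 0"
    using F frontier by (subst Min_gr_iff) (auto simp: F_def)
  then have e: "e > 0" by (simp add: e_def)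
  have e_le: "3 * e \<le> t" if "t \<in> insert 1 ((\<lambda>v. \<bar>?d v\<bar>) ` F)" for t
    unfolding e_def using Min_le[OF _ that] F by simp
  have gap: "?d v > e" if v: "v \<in> \<Lambda> y" "?d v > - (2 * e)" for v
  proof -
    have "?d v \<ge> - 1" using v(2) e_le[of 1] e by simp
    then have "3 * e \<le> \<bar>?d v\<bar>" using v(1) by (intro e_le) (simp add: F_def)
    then show ?thesis using v(2) e by linarith
  qed
  define V where "V = {v. ?d v > - (2 * e)}"
  have card_V: "\<Lambda> y \<inter> V = \<Lambda> y \<inter> thinning_triangle \<sigma>"
    using gap e unfolding V_def thinning_triangle_eq[OF \<sigma>] by force
  have "\<forall>\<^sub>F R in at_top. rescaled_wedge R \<sigma> \<subseteq> {v. ?d v \<ge> - e} \<and> {v. ?d v > e} \<subseteq> rescaled_wedge R \<sigma>"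
    by (intro eventually_conj eventually_rescaled_wedge_subset eventually_subset_rescaled_wedge \<sigma> e)
  then obtain R0 where R0: "\<And>R. R \<ge> R0 \<Longrightarrow>
      rescaled_wedge R \<sigma> \<subseteq> {v. ?d v \<ge> - e} \<and> {v. ?d v > e} \<subseteq> rescaled_wedge R \<sigma>"
    by (auto simp: eventually_at_top_linorder)
  obtain n where n: "R0 \<le> real n" using real_arch_simple by blast
  have "\<forall>\<^sub>F z in nhds y. \<forall>S. {v. ?d v > e} \<subseteq> S \<longrightarrow> S \<subseteq> {v. ?d v \<ge> - e} \<longrightarrow>
      card (\<Lambda> z \<inter> S) = card (\<Lambda> y \<inter> V)"
  proof (rule card_locally_constant[OF discrete vc])
    show "open {v. ?d v > e}" by (intro open_Collect_less cont continuous_intros)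
    have "closed {v. ?d v \<ge> - e}" by (intro closed_Collect_le cont continuous_intros)
    then show "compact {v. ?d v \<ge> - e}"
      using bounded_triangle_depth[OF \<sigma>, of e] by (simp add: compact_eq_bounded_closed)
    show "open V" unfolding V_def by (intro open_Collect_less cont continuous_intros)
    show "bounded V"
      by (rule bounded_subset[OF bounded_triangle_depth[OF \<sigma>, of "2 * e"]]) (auto simp: V_def)
    show "\<Lambda> y \<inter> V \<subseteq> {v. ?d v > e}" using gap by (auto simp: V_def)
  qed (use e in \<open>auto simp: V_def\<close>)
  then have "\<forall>\<^sub>F z in nhds y. P (card (\<Lambda> z \<inter> thinning_triangle \<sigma>)) \<and>
      (\<forall>R\<ge>real n. P (card (\<Lambda> z \<inter> rescaled_wedge R \<sigma>)))"
  proof eventually_elim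
    case (elim z)
    have "{v. ?d v > e} \<subseteq> thinning_triangle \<sigma>" "thinning_triangle \<sigma> \<subseteq> {v. ?d v \<ge> - e}"
      using e by (auto simp: thinning_triangle_eq[OF \<sigma>])
    then have "card (\<Lambda> z \<inter> thinning_triangle \<sigma>) = card (\<Lambda> y \<inter> V)" using elim by blast
    moreover have "card (\<Lambda> z \<inter> rescaled_wedge R \<sigma>) = card (\<Lambda> y \<inter> V)" if "R \<ge> real n" for R
      using elim R0[of R] order_trans[OF n that] by blast
    ultimately show ?case using P card_V by simp
  qed
  then have "y \<in> stable_count \<sigma> P n"
    unfolding stable_count_def interior_def eventually_nhds by blast
  then show ?thesis ..
qed

text \<open>The event contains the open union of the sets \<open>stable_count \<sigma> P n\<close>,
  and by \<open>mem_stable_count\<close> the difference lies in a null set. It need not itself be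
  Borel, hence the completion.\<close>

lemma
  assumes \<sigma>: "\<sigma> > 0"
  shows sets_triangle_count:
      "{y. P (card (\<Lambda> y \<inter> thinning_triangle \<sigma>))} \<in> sets (completion \<nu>)"
    and measure_triangle_count:
      "measure (completion \<nu>) {y. P (card (\<Lambda> y \<inter> thinning_triangle \<sigma>))}
        = measure \<nu> (\<Union>n. stable_count \<sigma> P n)"
proof -
  let ?A = "{y. P (card (\<Lambda> y \<inter> thinning_triangle \<sigma>))}" and ?W = "\<Union>n. stable_count \<sigma> P n"
  have "?W \<subseteq> ?A" using stable_count_subset by blast
  define D where "D = ?A - ?W"
  have A: "?A = ?W \<union> D" using \<open>?W \<subseteq> ?A\<close> by (auto simp: D_def)
  have W: "?W \<in> sets \<nu>" using open_stable_count by (simp add: borel_open open_UN)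
  have "AE y in \<nu>. y \<notin> D"
    using AE_vaguely_continuous AE_config_avoids_frontier[OF \<sigma>]
  proof eventually_elim
    case (elim y)
    have "y \<in> ?W" if "y \<in> ?A"
      using mem_stable_count[where P = P, OF \<sigma> elim] that by simp
    then show ?case by (auto simp: D_def)
  qed
  then obtain N where "{y \<in> space \<nu>. \<not> y \<notin> D} \<subseteq> N" "N \<in> null_sets \<nu>"
    unfolding eventually_ae_filter by blast
  then have null: "D \<in> null_sets (completion \<nu>)" by (auto simp: null_sets_completion_iff2)
  have "?W \<union> D \<in> sets (completion \<nu>)"
    by (rule sets.Un[OF sets_completionI_sets[OF W] null_setsD2[OF null]])
  then show "?A \<in> sets (completion \<nu>)" by (simp only: A)
  have "measure (completion \<nu>) (?W \<union> D) = measure (completion \<nu>) ?W"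
    by (rule measure_Un_null_set[OF sets_completionI_sets[OF W] null])
  then show "measure (completion \<nu>) ?A = measure \<nu> ?W"
    using W by (simp only: A measure_completion)
qed

text \<open>Half of \<open>e\<close> pays for replacing the union of the stable sets by a single
  one, the other half for passing from \<open>\<nu>\<close> to the expanding circle. For
  \<open>R \<ge> real n\<close>, membership of the orbit point in the stable set forces
  \<open>P\<close> of the wedge count.\<close>

lemma eventually_wedge_count_ge:
  assumes \<sigma>: "\<sigma> > 0" and e: "e > 0"
  shows "\<forall>\<^sub>F R in at_top. measure circle_measure {\<theta>. P (card (wedge R \<theta> \<sigma> \<inter> \<Lambda> x))}
    > measure (completion \<nu>) {y. P (card (\<Lambda> y \<inter> thinning_triangle \<sigma>))} - e"
proof -
  interpret circle: prob_space circle_measure by (rule prob_space_circle_measure)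
  let ?W = "stable_count \<sigma> P"
  have "(\<lambda>n. measure \<nu> (?W n)) \<longlonglongrightarrow> measure \<nu> (\<Union>n. ?W n)"
    using incseq_stable_count open_stable_count
    by (intro finite_Lim_measure_incseq) (auto simp: borel_open)
  then have "\<forall>\<^sub>F n in sequentially. measure \<nu> (?W n) > measure \<nu> (\<Union>n. ?W n) - e / 2"
    using e by (intro order_tendstoD(1)) auto
  then obtain n where n: "measure \<nu> (?W n) > measure \<nu> (\<Union>n. ?W n) - e / 2"
    using eventually_happens'[OF sequentially_bot] by blast
  have "\<forall>\<^sub>F R in at_top. measure (expanding_circle act x R) (?W n) > measure \<nu> (?W n) - e / 2"
    using e by (intro weak_star_liminf_open[OF locally_compact radon weak_star
          prob_space_expanding_circle sets_expanding_circle open_stable_count]) simp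
  then show ?thesis using eventually_ge_at_top[of "real n"]
  proof eventually_elim
    case (elim R)
    have "measure (expanding_circle act x R) (?W n)
        = measure circle_measure {\<theta>. act (geo (2 * ln R) ** rot (- \<theta>)) x \<in> ?W n}"
      by (intro measure_expanding_circle_reflect[symmetric] borel_open open_stable_count)
    also have "\<dots> \<le> measure circle_measure {\<theta>. P (card (wedge R \<theta> \<sigma> \<inter> \<Lambda> x))}"
    proof (rule circle.finite_measure_mono)
      show "{\<theta>. act (geo (2 * ln R) ** rot (- \<theta>)) x \<in> ?W n} \<subseteq> {\<theta>. P (card (wedge R \<theta> \<sigma> \<inter> \<Lambda> x))}"
      proof (intro subsetI CollectI)
        fix \<theta> assume "\<theta> \<in> {\<theta>. act (geo (2 * ln R) ** rot (- \<theta>)) x \<in> ?W n}"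
        then have "act (geo (2 * ln R) ** rot (- \<theta>)) x \<in> ?W n" by simp
        from subsetD[OF stable_count_subset this] elim(2)
        show "P (card (wedge R \<theta> \<sigma> \<inter> \<Lambda> x))" by (simp add: card_wedge_config)
      qed
    qed (simp add: sets_wedge_count)
    finally show ?case using elim(1) n measure_triangle_count[OF \<sigma>, of P] by linarith
  qed
qed

text \<open>The lower bound applied to both \<open>P\<close> and its negation gives convergence.\<close>
lemma wedge_count_tendsto:
  assumes \<sigma>: "\<sigma> > 0"
  shows "((\<lambda>R. measure circle_measure {\<theta>. P (card (wedge R \<theta> \<sigma> \<inter> \<Lambda> x))}) \<longlongrightarrow>
    measure (completion \<nu>) {y. P (card (\<Lambda> y \<inter> thinning_triangle \<sigma>))}) at_top"
proof (rule tendstoI)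
  interpret circle: prob_space circle_measure by (rule prob_space_circle_measure)
  interpret completion: prob_space "completion \<nu>"
    by (rule prob_spaceI) (simp add: emeasure_space_1[simplified])
  fix e :: real assume e: "e > 0"
  have circle: "measure circle_measure {\<theta>. \<not> P (card (wedge R \<theta> \<sigma> \<inter> \<Lambda> x))}
      = 1 - measure circle_measure {\<theta>. P (card (wedge R \<theta> \<sigma> \<inter> \<Lambda> x))}" for R
    using circle.prob_compl[of "{\<theta>. P (card (wedge R \<theta> \<sigma> \<inter> \<Lambda> x))}"] sets_wedge_count
    by (simp add: Compl_eq_Diff_UNIV[symmetric] Collect_neg_eq)
  have limit: "measure (completion \<nu>) {y. \<not> P (card (\<Lambda> y \<inter> thinning_triangle \<sigma>))}
      = 1 - measure (completion \<nu>) {y. P (card (\<Lambda> y \<inter> thinning_triangle \<sigma>))}"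
    using completion.prob_compl[OF sets_triangle_count[OF \<sigma>, of P]]
    by (simp add: Compl_eq_Diff_UNIV[symmetric] Collect_neg_eq)
  show "\<forall>\<^sub>F R in at_top. dist (measure circle_measure {\<theta>. P (card (wedge R \<theta> \<sigma> \<inter> \<Lambda> x))})
      (measure (completion \<nu>) {y. P (card (\<Lambda> y \<inter> thinning_triangle \<sigma>))}) < e"
    using eventually_wedge_count_ge[OF \<sigma> e, of P] eventually_wedge_count_ge[OF \<sigma> e, of "\<lambda>k. \<not> P k"]
  proof eventually_elim
    case (elim R)
    then show ?case unfolding circle limit dist_real_def by linarith
  qed
qed

end

theorem theorem2p6:
  fixes act :: "real^2^2 \<Rightarrow> 'a::metric_space \<Rightarrow> 'a"
    and \<Lambda> :: "'a \<Rightarrow> (real^2) set"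
    and x :: 'a
    and \<nu> :: "'a measure"
    and \<sigma> :: real
  assumes "locally_compact_space (euclidean :: 'a topology)"
    and "continuous_SL2R_action act"
    and "\<And>y. discrete_config (\<Lambda> y)"
    and "equivariant act \<Lambda>"
    and "radon_probability \<nu>"
    and "AE y in \<nu>. vaguely_continuous_at \<Lambda> y"
    and "weak_star_tendsto (expanding_circle act x) \<nu> at_top"
    and "\<sigma> > 0"
  shows "{y. \<Lambda> y \<inter> thinning_triangle \<sigma> = {}} \<in> sets (completion \<nu>)
      \<and> ((\<lambda>R. measure circle_measure {\<theta>. wedge R \<theta> \<sigma> \<inter> \<Lambda> x = {}})
           \<longlongrightarrow> measure (completion \<nu>) {y. \<Lambda> y \<inter> thinning_triangle \<sigma> = {}}) at_top
      \<and> (\<forall>i::nat.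
            {y. card (\<Lambda> y \<inter> thinning_triangle \<sigma>) = i} \<in> sets (completion \<nu>)
          \<and> ((\<lambda>R. measure circle_measure {\<theta>. card (wedge R \<theta> \<sigma> \<inter> \<Lambda> x) = i})
               \<longlongrightarrow> measure (completion \<nu>) {y. card (\<Lambda> y \<inter> thinning_triangle \<sigma>) = i}) at_top)"
proof -
  interpret equidistributing_circles act \<Lambda> x \<nu>
    using assms(1-7) by unfold_locales
  \<comment> \<open>Since \<open>card\<close> is 0 on infinite sets as well, reading emptiness as
    count 0 relies on finiteness of the configuration in bounded sets.\<close>
  have "bounded (thinning_triangle \<sigma>)"
    using bounded_triangle_depth[OF assms(8), of 0] by (simp add: thinning_triangle_eq[OF assms(8)])
  then have triangle: "\<Lambda> y \<inter> thinning_triangle \<sigma> = {} \<longleftrightarrow> card (\<Lambda> y \<inter> thinning_triangle \<sigma>) = 0" for y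
    using finite_config_Int by simp
  have wedge: "wedge R \<theta> \<sigma> \<inter> \<Lambda> x = {} \<longleftrightarrow> card (wedge R \<theta> \<sigma> \<inter> \<Lambda> x) = 0" for R \<theta>
    using finite_config_Int[OF bounded_wedge] by (simp add: Int_commute)
  note facts = sets_triangle_count[OF assms(8)] wedge_count_tendsto[OF assms(8)]
  show ?thesis
    unfolding triangle wedge
    using facts[of "\<lambda>k. k = 0"] facts[of "\<lambda>k. k = i" for i] by blast
qed

end
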